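(* For every $n\in\omega$ and every sequent $\Gamma\Rightarrow\Delta$ of first-order arithmetic: if $\Gamma\Rightarrow\Delta$ has a $\mathrm{CPA}$-proof in which every bud and every companion is labelled by a sequent all of whose formulas are $\Pi_n$ formulas, then $\Gamma\Rightarrow\Delta$ has a $\mathrm{PA}$-proof in which every instance of the induction axioms is on a $\Pi_{n+1}$ formula.
   Context: Language of first-order arithmetic: terms from variables, $0,S,+,\cdot$; formulas from $s=t,\bot,\wedge,\vee,\to,\forall,\exists$; $\Pi_n$ is the usual arithmetical hierarchy class. Sequents $\Gamma\Rightarrow\Delta$ consist of finite sets of formulas. $\mathrm{PA}$: classical multi-conclusion sequent calculus with the standard classical first-order rules with equality, weakening, cut, arithmetic axioms $\Rightarrow 0\neq St$, $Ss=St\Rightarrow s=t$, $\Rightarrow s+0=s$, $\Rightarrow s+St=S(s+t)$, $\Rightarrow s\cdot 0=0$, $\Rightarrow s\cdot St=(s\cdot t)+s$, and induction axioms $\varphi(0),\forall x.\,\varphi(x)\to\varphi(Sx)\Rightarrow\varphi(s)$; proofs are finite trees. $\mathrm{CPA}$: rules of $\mathrm{PA}$ without induction axioms plus $\textsc{Case}_x$ (from $\Gamma[0/x]\Rightarrow\Delta[0/x]$ and $\Gamma[Sx/x]\Rightarrow\Delta[Sx/x]$ infer $\Gamma\Rightarrow\Delta$). Pre-proofs are finite trees with a partial map $\beta$ sending some leaves (buds) to inner nodes (companions), non-bud nodes labelled by rule instances whose premises label the children, each bud carrying its companion's sequent. An infinite branch starts at the root and each step goes to a child or from a bud to its companion.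 A $\mathrm{CPA}$-proof is a pre-proof such that along every infinite branch some variable $x$ is, from some point on, free in every sequent of the branch and the branch passes instances of $\textsc{Case}_x$ infinitely often. *)

theory Defs
  imports Main "HOL-Library.FSet"
begin

section \<open>First-order arithmetic\<close>

text \<open>
  Formulas are in pure de Bruijn notation, so that equality of formulas is alpha-equivalence:
  below \<open>d\<close> quantifiers, index \<open>k < d\<close> refers to the \<open>k\<close>-th enclosing quantifier (counted from the
  inside) and index \<open>k \<ge> d\<close> refers to the free variable named \<open>k - d\<close>.
\<close>

datatype tm = Var nat | Zero | Succ tm | Add tm tm | Mul tm tm

datatype fm = Eq tm tm | Bot | And fm fm | Or fm fm | Imp fm fm | All fm | Ex fm

primrec fv_tm :: "tm \<Rightarrow> nat set" where
  "fv_tm (Var k) = {k}"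
| "fv_tm Zero = {}"
| "fv_tm (Succ t) = fv_tm t"
| "fv_tm (Add s t) = fv_tm s \<union> fv_tm t"
| "fv_tm (Mul s t) = fv_tm s \<union> fv_tm t"

primrec fv :: "fm \<Rightarrow> nat set" where
  "fv (Eq s t) = fv_tm s \<union> fv_tm t"
| "fv Bot = {}"
| "fv (And \<phi> \<psi>) = fv \<phi> \<union> fv \<psi>"
| "fv (Or \<phi> \<psi>) = fv \<phi> \<union> fv \<psi>"
| "fv (Imp \<phi> \<psi>) = fv \<phi> \<union> fv \<psi>"
| "fv (All \<phi>) = {k. Suc k \<in> fv \<phi>}"
| "fv (Ex \<phi>) = {k. Suc k \<in> fv \<phi>}"

primrec subst_tm :: "(nat \<Rightarrow> tm) \<Rightarrow> tm \<Rightarrow> tm" where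
  "subst_tm \<sigma> (Var k) = \<sigma> k"
| "subst_tm \<sigma> Zero = Zero"
| "subst_tm \<sigma> (Succ t) = Succ (subst_tm \<sigma> t)"
| "subst_tm \<sigma> (Add s t) = Add (subst_tm \<sigma> s) (subst_tm \<sigma> t)"
| "subst_tm \<sigma> (Mul s t) = Mul (subst_tm \<sigma> s) (subst_tm \<sigma> t)"

definition shift_tm :: "tm \<Rightarrow> tm" where
  "shift_tm = subst_tm (\<lambda>k. Var (Suc k))"

definition under_binder :: "(nat \<Rightarrow> tm) \<Rightarrow> nat \<Rightarrow> tm" where
  "under_binder \<sigma> = case_nat (Var 0) (\<lambda>k. shift_tm (\<sigma> k))"

primrec subst :: "(nat \<Rightarrow> tm) \<Rightarrow> fm \<Rightarrow> fm" where
  "subst \<sigma> (Eq s t) = Eq (subst_tm \<sigma> s) (subst_tm \<sigma> t)"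
| "subst \<sigma> Bot = Bot"
| "subst \<sigma> (And \<phi> \<psi>) = And (subst \<sigma> \<phi>) (subst \<sigma> \<psi>)"
| "subst \<sigma> (Or \<phi> \<psi>) = Or (subst \<sigma> \<phi>) (subst \<sigma> \<psi>)"
| "subst \<sigma> (Imp \<phi> \<psi>) = Imp (subst \<sigma> \<phi>) (subst \<sigma> \<psi>)"
| "subst \<sigma> (All \<phi>) = All (subst (under_binder \<sigma>) \<phi>)"
| "subst \<sigma> (Ex \<phi>) = Ex (subst (under_binder \<sigma>) \<phi>)"

text \<open>
  If \<open>\<phi>\<close> is the body of a quantifier (its distinguished variable being index 0), then
  \<open>inst \<phi> t\<close> is the instance of \<open>\<phi>\<close> at \<open>t\<close>.
\<close>

definition inst :: "fm \<Rightarrow> tm \<Rightarrow> fm" where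
  "inst \<phi> t = subst (case_nat t Var) \<phi>"


section \<open>The arithmetical hierarchy\<close>

text \<open>The order is not part of the language: \<open>s < t\<close> abbreviates \<open>\<exists>z. s + Sz = t\<close>.\<close>

definition Less :: "tm \<Rightarrow> tm \<Rightarrow> fm" where
  "Less s t = Ex (Eq (Add (shift_tm s) (Succ (Var 0))) (shift_tm t))"

text \<open>The bounding term of a bounded quantifier does not contain the quantified variable.\<close>

inductive bounded_fm :: "fm \<Rightarrow> bool" where
  "bounded_fm (Eq s t)"
| "bounded_fm Bot"
| "bounded_fm \<phi> \<Longrightarrow> bounded_fm \<psi> \<Longrightarrow> bounded_fm (And \<phi> \<psi>)"
| "bounded_fm \<phi> \<Longrightarrow> bounded_fm \<psi> \<Longrightarrow> bounded_fm (Or \<phi> \<psi>)"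
| "bounded_fm \<phi> \<Longrightarrow> bounded_fm \<psi> \<Longrightarrow> bounded_fm (Imp \<phi> \<psi>)"
| "bounded_fm \<phi> \<Longrightarrow> bounded_fm (All (Imp (Less (Var 0) (shift_tm t)) \<phi>))"
| "bounded_fm \<phi> \<Longrightarrow> bounded_fm (Ex (And (Less (Var 0) (shift_tm t)) \<phi>))"

text \<open>Quantifiers come in (possibly empty) blocks.\<close>

inductive Sigma_fm :: "nat \<Rightarrow> fm \<Rightarrow> bool" and Pi_fm :: "nat \<Rightarrow> fm \<Rightarrow> bool" where
  "bounded_fm \<phi> \<Longrightarrow> Sigma_fm 0 \<phi>"
| "Pi_fm n \<phi> \<Longrightarrow> Sigma_fm (Suc n) \<phi>"
| "Sigma_fm (Suc n) \<phi> \<Longrightarrow> Sigma_fm (Suc n) (Ex \<phi>)"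
| "bounded_fm \<phi> \<Longrightarrow> Pi_fm 0 \<phi>"
| "Sigma_fm n \<phi> \<Longrightarrow> Pi_fm (Suc n) \<phi>"
| "Pi_fm (Suc n) \<phi> \<Longrightarrow> Pi_fm (Suc n) (All \<phi>)"


section \<open>Sequents and rules\<close>

type_synonym sequent = "fm fset \<times> fm fset"

definition fv_fset :: "fm fset \<Rightarrow> nat set" where
  "fv_fset \<Gamma> = (\<Union>\<phi>\<in>fset \<Gamma>. fv \<phi>)"

definition fv_seq :: "sequent \<Rightarrow> nat set" where
  "fv_seq s = fv_fset (fst s) \<union> fv_fset (snd s)"

definition subst_seq :: "(nat \<Rightarrow> tm) \<Rightarrow> sequent \<Rightarrow> sequent" where
  "subst_seq \<sigma> s = (subst \<sigma> |`| fst s, subst \<sigma> |`| snd s)"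

definition Pi_seq :: "nat \<Rightarrow> sequent \<Rightarrow> bool" where
  "Pi_seq n s \<longleftrightarrow> (\<forall>\<phi>\<in>fset (fst s) \<union> fset (snd s). Pi_fm n \<phi>)"

text \<open>
  The rules common to PA and CPA, as a relation between the list of premises and the conclusion.
  As sequents consist of sets, contraction and exchange are implicit. Rule \<open>eqL\<close> infers
  \<open>s = t, \<Gamma>[s/x,t/y] \<Rightarrow> \<Delta>[s/x,t/y]\<close> from \<open>\<Gamma>[t/x,s/y] \<Rightarrow> \<Delta>[t/x,s/y]\<close>,
  with simultaneous substitutions.
\<close>

inductive common_rule :: "sequent list \<Rightarrow> sequent \<Rightarrow> bool" where
  ax: "common_rule [] (finsert \<phi> \<Gamma>, finsert \<phi> \<Delta>)"
| botL: "common_rule [] (finsert Bot \<Gamma>, \<Delta>)"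
| andL: "common_rule [(finsert \<phi> (finsert \<psi> \<Gamma>), \<Delta>)] (finsert (And \<phi> \<psi>) \<Gamma>, \<Delta>)"
| andR: "common_rule [(\<Gamma>, finsert \<phi> \<Delta>), (\<Gamma>, finsert \<psi> \<Delta>)] (\<Gamma>, finsert (And \<phi> \<psi>) \<Delta>)"
| orL: "common_rule [(finsert \<phi> \<Gamma>, \<Delta>), (finsert \<psi> \<Gamma>, \<Delta>)] (finsert (Or \<phi> \<psi>) \<Gamma>, \<Delta>)"
| orR: "common_rule [(\<Gamma>, finsert \<phi> (finsert \<psi> \<Delta>))] (\<Gamma>, finsert (Or \<phi> \<psi>) \<Delta>)"
| impL: "common_rule [(\<Gamma>, finsert \<phi> \<Delta>), (finsert \<psi> \<Gamma>, \<Delta>)] (finsert (Imp \<phi> \<psi>) \<Gamma>, \<Delta>)"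
| impR: "common_rule [(finsert \<phi> \<Gamma>, finsert \<psi> \<Delta>)] (\<Gamma>, finsert (Imp \<phi> \<psi>) \<Delta>)"
| allL: "common_rule [(finsert (inst \<phi> t) \<Gamma>, \<Delta>)] (finsert (All \<phi>) \<Gamma>, \<Delta>)"
| allR: "y \<notin> fv_seq (\<Gamma>, finsert (All \<phi>) \<Delta>) \<Longrightarrow>
    common_rule [(\<Gamma>, finsert (inst \<phi> (Var y)) \<Delta>)] (\<Gamma>, finsert (All \<phi>) \<Delta>)"
| exL: "y \<notin> fv_seq (finsert (Ex \<phi>) \<Gamma>, \<Delta>) \<Longrightarrow>
    common_rule [(finsert (inst \<phi> (Var y)) \<Gamma>, \<Delta>)] (finsert (Ex \<phi>) \<Gamma>, \<Delta>)"
| exR: "common_rule [(\<Gamma>, finsert (inst \<phi> t) \<Delta>)] (\<Gamma>, finsert (Ex \<phi>) \<Delta>)"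
| eqR: "common_rule [] ({||}, {|Eq t t|})"
| eqL: "x \<noteq> y \<Longrightarrow> subst_seq (Var(x := s, y := t)) (\<Gamma>, \<Delta>) = (\<Gamma>', \<Delta>') \<Longrightarrow>
    common_rule [subst_seq (Var(x := t, y := s)) (\<Gamma>, \<Delta>)] (finsert (Eq s t) \<Gamma>', \<Delta>')"
| weakening: "\<Gamma> |\<subseteq>| \<Gamma>' \<Longrightarrow> \<Delta> |\<subseteq>| \<Delta>' \<Longrightarrow> common_rule [(\<Gamma>, \<Delta>)] (\<Gamma>', \<Delta>')"
| cut: "common_rule [(\<Gamma>, finsert \<phi> \<Delta>), (finsert \<phi> \<Gamma>, \<Delta>)] (\<Gamma>, \<Delta>)"
| zero_neq_succ: "common_rule [] ({||}, {|Imp (Eq Zero (Succ t)) Bot|})"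
| succ_inj: "common_rule [] ({|Eq (Succ s) (Succ t)|}, {|Eq s t|})"
| add_zero: "common_rule [] ({||}, {|Eq (Add s Zero) s|})"
| add_succ: "common_rule [] ({||}, {|Eq (Add s (Succ t)) (Succ (Add s t))|})"
| mul_zero: "common_rule [] ({||}, {|Eq (Mul s Zero) Zero|})"
| mul_succ: "common_rule [] ({||}, {|Eq (Mul s (Succ t)) (Add (Mul s t) s)|})"

text \<open>
  Nodes of proofs carry a rule label, because a sequent and its premises need not determine of which
  rule they are an instance. The induction formula is given as a quantifier body: the induction
  variable is index 0.
\<close>

datatype (discs_sels) rule = Common | Induction fm | Case nat

inductive rule_instance :: "rule \<Rightarrow> sequent list \<Rightarrow> sequent \<Rightarrow> bool" where
  "common_rule ps c \<Longrightarrow> rule_instance Common ps c"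
| "rule_instance (Induction \<phi>) []
    ({|inst \<phi> Zero, All (Imp \<phi> (subst (Var(0 := Succ (Var 0))) \<phi>))|}, {|inst \<phi> s|})"
| "rule_instance (Case x)
    [subst_seq (Var(x := Zero)) c, subst_seq (Var(x := Succ (Var x))) c] c"


section \<open>Proofs\<close>

datatype ptree = Bud sequent | Infer rule sequent "ptree list"

fun root_seq :: "ptree \<Rightarrow> sequent" where
  "root_seq (Bud c) = c"
| "root_seq (Infer r c ts) = c"

text \<open>Nodes are addressed by the list of child numbers leading to them from the root.\<close>

fun subtree :: "ptree \<Rightarrow> nat list \<Rightarrow> ptree option" where
  "subtree t [] = Some t"
| "subtree (Bud c) (i # p) = None"
| "subtree (Infer r c ts) (i # p) = (if i < length ts then subtree (ts ! i) p else None)"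

definition node_seq :: "ptree \<Rightarrow> nat list \<Rightarrow> sequent" where
  "node_seq t p = root_seq (the (subtree t p))"

definition bud_nodes :: "ptree \<Rightarrow> nat list set" where
  "bud_nodes t = {p. \<exists>c. subtree t p = Some (Bud c)}"

definition inner_nodes :: "ptree \<Rightarrow> nat list set" where
  "inner_nodes t = {p. \<exists>r c ts. subtree t p = Some (Infer r c ts) \<and> ts \<noteq> []}"

definition rule_nodes :: "ptree \<Rightarrow> (rule \<Rightarrow> bool) \<Rightarrow> nat list set" where
  "rule_nodes t P = {p. \<exists>r c ts. subtree t p = Some (Infer r c ts) \<and> P r}"

definition locally_correct :: "ptree \<Rightarrow> bool" where
  "locally_correct t \<longleftrightarrow> (\<forall>p r c ts. subtree t p = Some (Infer r c ts) \<longrightarrow>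
     rule_instance r (map root_seq ts) c)"

definition PA_proof :: "ptree \<Rightarrow> bool" where
  "PA_proof t \<longleftrightarrow> locally_correct t \<and> bud_nodes t = {} \<and> rule_nodes t is_Case = {}"

definition CPA_preproof :: "ptree \<Rightarrow> (nat list \<rightharpoonup> nat list) \<Rightarrow> bool" where
  "CPA_preproof t \<beta> \<longleftrightarrow> locally_correct t \<and> rule_nodes t is_Induction = {} \<and>
     dom \<beta> = bud_nodes t \<and> ran \<beta> \<subseteq> inner_nodes t \<and>
     (\<forall>p q. \<beta> p = Some q \<longrightarrow> node_seq t p = node_seq t q)"

definition infinite_branch :: "ptree \<Rightarrow> (nat list \<rightharpoonup> nat list) \<Rightarrow> (nat \<Rightarrow> nat list) \<Rightarrow> bool" where
  "infinite_branch t \<beta> b \<longleftrightarrow> b 0 = [] \<and>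
     (\<forall>i. (\<exists>j. b (Suc i) = b i @ [j] \<and> subtree t (b (Suc i)) \<noteq> None) \<or>
          \<beta> (b i) = Some (b (Suc i)))"

definition CPA_proof :: "ptree \<Rightarrow> (nat list \<rightharpoonup> nat list) \<Rightarrow> bool" where
  "CPA_proof t \<beta> \<longleftrightarrow> CPA_preproof t \<beta> \<and>
     (\<forall>b. infinite_branch t \<beta> b \<longrightarrow>
       (\<exists>x. (\<forall>\<^sub>\<infinity>i. x \<in> fv_seq (node_seq t (b i))) \<and>
            (\<exists>\<^sub>\<infinity>i. b i \<in> rule_nodes t (\<lambda>r. r = Case x))))"

end

theory Submission
  imports Defs "HOL-Library.Countable" "HOL-Library.Infinite_Set"
begin

text \<open>
  If the end sequent has no PA-proof with induction on \<open>\<Pi>\<^sub>n\<^sub>+\<^sub>1\<close> formulas, a Henkin construction extends it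
  to a set \<open>T\<close> of formulas that acts as a model: the elements are the terms, and a formula holds under
  a valuation if its instance lies in \<open>T\<close>. In \<open>T\<close> one has induction for all \<open>\<Pi>\<^sub>n\<^sub>+\<^sub>1\<close>-definable predicates.
  Every cyclic proof is sound in \<open>T\<close>, although \<open>T\<close> may be nonstandard. A falsified node of the proof
  passes falsity on to a neighbour in the proof graph; a strongly connected part of the graph has a
  variable \<open>x\<close> free in all of its sequents that some edge decreases. Fix the value of \<open>x\<close>, assume the
  sequents hold for smaller values, delete the edges that decrease \<open>x\<close>, and recurse into what remains
  with \<open>x\<close> as a parameter. Every cycle passes through a bud, so each induction only has to speak of
  buds. These carry \<open>\<Pi>\<^sub>n\<close> formulas, so the universally quantified truth of their sequents is
  \<open>\<Pi>\<^sub>n\<^sub>+\<^sub>1\<close>.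
\<close>

section \<open>Substitution\<close>

lemma subst_tm_cong: "(\<And>k. k \<in> fv_tm t \<Longrightarrow> \<sigma> k = \<tau> k) \<Longrightarrow> subst_tm \<sigma> t = subst_tm \<tau> t"
  by (induction t) auto

lemma subst_cong: "(\<And>k. k \<in> fv \<phi> \<Longrightarrow> \<sigma> k = \<tau> k) \<Longrightarrow> subst \<sigma> \<phi> = subst \<tau> \<phi>"
proof (induction \<phi> arbitrary: \<sigma> \<tau>)
  case (All \<phi>)
  have "under_binder \<sigma> k = under_binder \<tau> k" if "k \<in> fv \<phi>" for k
    using that All.prems by (cases k) (auto simp: under_binder_def)
  then have "subst (under_binder \<sigma>) \<phi> = subst (under_binder \<tau>) \<phi>" by (rule All.IH)
  then show ?case by simp
next
  case (Ex \<phi>)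
  have "under_binder \<sigma> k = under_binder \<tau> k" if "k \<in> fv \<phi>" for k
    using that Ex.prems by (cases k) (auto simp: under_binder_def)
  then have "subst (under_binder \<sigma>) \<phi> = subst (under_binder \<tau>) \<phi>" by (rule Ex.IH)
  then show ?case by simp
next
  case (Eq s t)
  have "subst_tm \<sigma> s = subst_tm \<tau> s" "subst_tm \<sigma> t = subst_tm \<tau> t"
    by (rule subst_tm_cong, simp add: Eq)+
  then show ?case by simp
next
  case (And \<phi> \<psi>)
  have "subst \<sigma> \<phi> = subst \<tau> \<phi>" by (rule And.IH(1)) (simp add: And.prems)
  moreover have "subst \<sigma> \<psi> = subst \<tau> \<psi>" by (rule And.IH(2)) (simp add: And.prems)
  ultimately show ?case by simp
next
  case (Or \<phi> \<psi>)
  have "subst \<sigma> \<phi> = subst \<tau> \<phi>" by (rule Or.IH(1)) (simp add: Or.prems)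
  moreover have "subst \<sigma> \<psi> = subst \<tau> \<psi>" by (rule Or.IH(2)) (simp add: Or.prems)
  ultimately show ?case by simp
next
  case (Imp \<phi> \<psi>)
  have "subst \<sigma> \<phi> = subst \<tau> \<phi>" by (rule Imp.IH(1)) (simp add: Imp.prems)
  moreover have "subst \<sigma> \<psi> = subst \<tau> \<psi>" by (rule Imp.IH(2)) (simp add: Imp.prems)
  ultimately show ?case by simp
qed simp

lemma subst_tm_comp: "subst_tm \<sigma> (subst_tm \<tau> t) = subst_tm (\<lambda>k. subst_tm \<sigma> (\<tau> k)) t"
  by (induction t) auto

lemma subst_tm_shift: "subst_tm \<sigma> (shift_tm t) = subst_tm (\<lambda>k. \<sigma> (Suc k)) t"
  by (simp add: shift_tm_def subst_tm_comp)

lemma shift_subst_tm: "shift_tm (subst_tm \<sigma> t) = subst_tm (\<lambda>k. shift_tm (\<sigma> k)) t"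
  by (simp add: shift_tm_def subst_tm_comp)

lemma under_binder_simps [simp]:
  "under_binder \<sigma> 0 = Var 0"
  "under_binder \<sigma> (Suc k) = shift_tm (\<sigma> k)"
  by (simp_all add: under_binder_def)

lemma under_binder_comp:
  "(\<lambda>k. subst_tm (under_binder \<sigma>) (under_binder \<tau> k)) = under_binder (\<lambda>k. subst_tm \<sigma> (\<tau> k))"
proof
  show "subst_tm (under_binder \<sigma>) (under_binder \<tau> k) = under_binder (\<lambda>k. subst_tm \<sigma> (\<tau> k)) k" for k
    by (cases k) (simp_all add: subst_tm_shift shift_subst_tm)
qed

lemma subst_comp: "subst \<sigma> (subst \<tau> \<phi>) = subst (\<lambda>k. subst_tm \<sigma> (\<tau> k)) \<phi>"
  by (induction \<phi> arbitrary: \<sigma> \<tau>) (simp_all add: subst_tm_comp under_binder_comp)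

lemma subst_tm_Var [simp]: "subst_tm Var t = t"
  by (induction t) auto

lemma under_binder_Var: "under_binder Var = Var"
proof
  show "under_binder Var k = Var k" for k
    by (cases k) (simp_all add: shift_tm_def)
qed

lemma subst_Var [simp]: "subst Var \<phi> = \<phi>"
  by (induction \<phi>) (simp_all add: under_binder_Var)

text \<open>Instantiation after a substitution under a binder merges into one substitution with
  \<open>t\<close> at index 0. This turns quantification over instances into quantification over
  values in a valuation.\<close>

lemma inst_subst: "inst (subst (under_binder \<sigma>) \<phi>) t = subst (case_nat t \<sigma>) \<phi>"
proof -
  have "subst_tm (case_nat t Var) (under_binder \<sigma> k) = case_nat t \<sigma> k" for k
    by (cases k) (simp_all add: subst_tm_shift)
  then show ?thesis by (simp add: inst_def subst_comp)
qed

lemma subst_inst: "subst \<sigma> (inst \<phi> t) = subst (case_nat (subst_tm \<sigma> t) \<sigma>) \<phi>"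
proof -
  have "subst_tm \<sigma> (case_nat t Var k) = case_nat (subst_tm \<sigma> t) \<sigma> k" for k
    by (cases k) simp_all
  then show ?thesis by (simp add: inst_def subst_comp)
qed

lemma fv_subst_tm: "fv_tm (subst_tm \<sigma> t) = (\<Union>k\<in>fv_tm t. fv_tm (\<sigma> k))"
  by (induction t) auto

lemma fv_shift_tm: "fv_tm (shift_tm t) = Suc ` fv_tm t"
  by (auto simp: shift_tm_def fv_subst_tm)

lemma fv_subst: "fv (subst \<sigma> \<phi>) \<subseteq> (\<Union>k\<in>fv \<phi>. fv_tm (\<sigma> k))"
proof (induction \<phi> arbitrary: \<sigma>)
  case (All \<phi>)
  show ?case
  proof
    fix x assume "x \<in> fv (subst \<sigma> (All \<phi>))"
    then obtain k where "k \<in> fv \<phi>" "Suc x \<in> fv_tm (under_binder \<sigma> k)"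
      using All.IH[of "under_binder \<sigma>"] by auto
    then show "x \<in> (\<Union>k\<in>fv (All \<phi>). fv_tm (\<sigma> k))"
      by (cases k) (auto simp: fv_shift_tm)
  qed
next
  case (Ex \<phi>)
  show ?case
  proof
    fix x assume "x \<in> fv (subst \<sigma> (Ex \<phi>))"
    then obtain k where "k \<in> fv \<phi>" "Suc x \<in> fv_tm (under_binder \<sigma> k)"
      using Ex.IH[of "under_binder \<sigma>"] by auto
    then show "x \<in> (\<Union>k\<in>fv (Ex \<phi>). fv_tm (\<sigma> k))"
      by (cases k) (auto simp: fv_shift_tm)
  qed
next
  case (And \<phi> \<psi>)
  show ?case using And.IH(1)[of \<sigma>] And.IH(2)[of \<sigma>] by auto
next
  case (Or \<phi> \<psi>)
  show ?case using Or.IH(1)[of \<sigma>] Or.IH(2)[of \<sigma>] by auto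
next
  case (Imp \<phi> \<psi>)
  show ?case using Imp.IH(1)[of \<sigma>] Imp.IH(2)[of \<sigma>] by auto
qed (simp_all add: fv_subst_tm)

lemma finite_fv_tm: "finite (fv_tm t)"
  by (induction t) auto

lemma finite_fv: "finite (fv \<phi>)"
proof (induction \<phi>)
  case (All \<phi>)
  then show ?case using finite_vimageI[of "fv \<phi>" Suc] by (simp add: vimage_def)
next
  case (Ex \<phi>)
  then show ?case using finite_vimageI[of "fv \<phi>" Suc] by (simp add: vimage_def)
qed (simp_all add: finite_fv_tm)

lemma finite_fv_seq: "finite (fv_seq c)"
  by (simp add: fv_seq_def fv_fset_def finite_fv)

lemma ex_fresh: "finite A \<Longrightarrow> \<exists>x::nat. x \<notin> A"
  by (rule ex_new_if_finite) simp_all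


section \<open>The arithmetical hierarchy under substitution\<close>

lemma subst_Less [simp]: "subst \<sigma> (Less s t) = Less (subst_tm \<sigma> s) (subst_tm \<sigma> t)"
  by (simp add: Less_def subst_tm_shift shift_subst_tm)

lemma bounded_fm_subst: "bounded_fm \<phi> \<Longrightarrow> bounded_fm (subst \<sigma> \<phi>)"
proof (induction arbitrary: \<sigma> rule: bounded_fm.induct)
  case (6 \<phi> t)
  show ?case
    using bounded_fm.intros(6)[OF "6.IH"[of "under_binder \<sigma>"], of "subst_tm \<sigma> t"]
    by (simp add: subst_tm_shift shift_subst_tm)
next
  case (7 \<phi> t)
  show ?case
    using bounded_fm.intros(7)[OF "7.IH"[of "under_binder \<sigma>"], of "subst_tm \<sigma> t"]
    by (simp add: subst_tm_shift shift_subst_tm)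
qed (auto intro: bounded_fm.intros)

lemma Sigma_Pi_fm_subst:
  "Sigma_fm m \<phi> \<Longrightarrow> Sigma_fm m (subst \<sigma> \<phi>)"
  "Pi_fm m \<phi> \<Longrightarrow> Pi_fm m (subst \<sigma> \<phi>)"
proof (induction arbitrary: \<sigma> and \<sigma> rule: Sigma_fm_Pi_fm.inducts)
qed (auto intro: Sigma_fm_Pi_fm.intros bounded_fm_subst)

lemma Sigma_Pi_fm_Suc:
  "Sigma_fm m \<phi> \<Longrightarrow> Sigma_fm (Suc m) \<phi>"
  "Pi_fm m \<phi> \<Longrightarrow> Pi_fm (Suc m) \<phi>"
  by (induction rule: Sigma_fm_Pi_fm.inducts) (auto intro: Sigma_fm_Pi_fm.intros)

lemma bounded_imp_Pi_fm: "bounded_fm \<phi> \<Longrightarrow> Pi_fm m \<phi>"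
  by (induction m) (auto intro: Sigma_Pi_fm_Suc Sigma_fm_Pi_fm.intros)


section \<open>Provability and Henkin sets\<close>

text \<open>Provability without trees and addresses, which suits the Henkin construction. PA proof
  trees are rebuilt only in \<open>prv_imp_PA_proof\<close>.\<close>

inductive prv :: "nat \<Rightarrow> sequent \<Rightarrow> bool" for n where
  common: "common_rule ps c \<Longrightarrow> (\<And>p. p \<in> set ps \<Longrightarrow> prv n p) \<Longrightarrow> prv n c"
| induction: "Pi_fm (Suc n) \<phi> \<Longrightarrow>
    prv n ({|inst \<phi> Zero, All (Imp \<phi> (subst (Var(0 := Succ (Var 0))) \<phi>))|}, {|inst \<phi> s|})"

lemma prv0: "common_rule [] c \<Longrightarrow> prv n c"
  by (erule prv.common) simp

lemma prv1: "common_rule [p] c \<Longrightarrow> prv n p \<Longrightarrow> prv n c"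
  by (erule prv.common) simp

lemma prv2: "common_rule [p, q] c \<Longrightarrow> prv n p \<Longrightarrow> prv n q \<Longrightarrow> prv n c"
  by (erule prv.common) auto

lemma prv_weaken: "prv n (\<Gamma>, \<Delta>) \<Longrightarrow> \<Gamma> |\<subseteq>| \<Gamma>' \<Longrightarrow> \<Delta> |\<subseteq>| \<Delta>' \<Longrightarrow> prv n (\<Gamma>', \<Delta>')"
  by (rule prv1[OF weakening])

lemma prv_ax:
  assumes "\<phi> |\<in>| \<Gamma>" "\<phi> |\<in>| \<Delta>"
  shows "prv n (\<Gamma>, \<Delta>)"
  using prv0[OF ax[of \<phi> \<Gamma> \<Delta>]] assms by (simp add: finsert_absorb)

lemma subtree_Infer_Some:
  "subtree (Infer r c ts) p = Some u \<longleftrightarrow>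
    p = [] \<and> u = Infer r c ts \<or> (\<exists>i q. p = i # q \<and> i < length ts \<and> subtree (ts ! i) q = Some u)"
  by (cases p) auto

text \<open>The proofs of the premises are grafted onto a new root. An address in the result is the
  root or lies in one of the grafted trees, so each condition on nodes is inherited.\<close>

lemma prv_imp_PA_proof:
  assumes "prv n c"
  shows "\<exists>t. PA_proof t \<and> root_seq t = c \<and>
           (\<forall>\<phi>. rule_nodes t (\<lambda>r. r = Induction \<phi>) \<noteq> {} \<longrightarrow> Pi_fm (Suc n) \<phi>)"
    (is "\<exists>t. ?proves t c")
  using assms
proof (induction rule: prv.induct)
  case (common ps c)
  then obtain f where f: "\<And>p. p \<in> set ps \<Longrightarrow> ?proves (f p) p" by metis
  let ?t = "Infer Common c (map f ps)"
  have roots: "map root_seq (map f ps) = ps" using f by (simp add: map_idI)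
  have sub: "r = Common \<and> d = c \<and> ts = map f ps \<or> (\<exists>p\<in>set ps. \<exists>q. subtree (f p) q = Some (Infer r d ts))"
    if u: "subtree ?t p = Some (Infer r d ts)" for p r d ts
  proof -
    consider "r = Common \<and> d = c \<and> ts = map f ps"
      | i q where "i < length ps" "subtree (f (ps ! i)) q = Some (Infer r d ts)"
      using u by (auto simp: subtree_Infer_Some)
    then show ?thesis by cases (use nth_mem in blast)+
  qed
  have "locally_correct ?t"
    unfolding locally_correct_def
  proof (intro allI impI)
    fix p r d ts assume "subtree ?t p = Some (Infer r d ts)"
    from sub[OF this] show "rule_instance r (map root_seq ts) d"
    proof (elim disjE conjE bexE exE)
      assume "r = Common" "d = c" "ts = map f ps"
      then show ?thesis using rule_instance.intros(1)[OF common.hyps(1)] roots by simp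
    next
      fix p q assume "p \<in> set ps" "subtree (f p) q = Some (Infer r d ts)"
      then show ?thesis using f unfolding PA_proof_def locally_correct_def by blast
    qed
  qed
  moreover have False if u: "subtree ?t p = Some (Bud d)" for p d
  proof -
    obtain i q where i: "i < length ps" and "subtree (f (ps ! i)) q = Some (Bud d)"
      using u by (auto simp: subtree_Infer_Some)
    then have "q \<in> bud_nodes (f (ps ! i))" by (auto simp: bud_nodes_def)
    then show False using f[OF nth_mem[OF i]] by (simp add: PA_proof_def)
  qed
  then have "bud_nodes ?t = {}" by (auto simp: bud_nodes_def)
  \<comment> \<open>Kept general in \<open>P\<close>, as it serves both for the absence of Case and
    for the bound on induction formulas.\<close>
  moreover have rule_nodes: "\<exists>p\<in>set ps. rule_nodes (f p) P \<noteq> {}" if "rule_nodes ?t P \<noteq> {}" "\<not> P Common" for P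
  proof -
    obtain p r d ts where "subtree ?t p = Some (Infer r d ts)" "P r"
      using \<open>rule_nodes ?t P \<noteq> {}\<close> by (auto simp: rule_nodes_def)
    with sub[OF this(1)] \<open>\<not> P Common\<close> show ?thesis
      unfolding rule_nodes_def by blast
  qed
  from rule_nodes[of is_Case] have "rule_nodes ?t is_Case = {}"
    using f by (auto simp: PA_proof_def)
  moreover have "Pi_fm (Suc n) \<phi>" if "rule_nodes ?t (\<lambda>r. r = Induction \<phi>) \<noteq> {}" for \<phi>
    using rule_nodes[OF that] f by auto
  ultimately show ?case unfolding PA_proof_def by (intro exI[of _ ?t]) auto
next
  case (induction \<phi> s)
  let ?c = "({|inst \<phi> Zero, All (Imp \<phi> (subst (Var(0 := Succ (Var 0))) \<phi>))|}, {|inst \<phi> s|})"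
  let ?t = "Infer (Induction \<phi>) ?c []"
  have "subtree ?t p = Some u \<longleftrightarrow> p = [] \<and> u = ?t" for p u
    by (cases p) auto
  then have "?proves ?t ?c"
    using induction rule_instance.intros(2)[of \<phi> s]
    by (auto simp: PA_proof_def locally_correct_def bud_nodes_def rule_nodes_def)
  then show ?case by blast
qed

section \<open>Extending an unprovable sequent to a Henkin set\<close>

instance tm :: countable by countable_datatype
instance fm :: countable by countable_datatype

definition decides :: "sequent \<Rightarrow> fm \<Rightarrow> bool" where
  "decides s \<phi> \<longleftrightarrow> (\<phi> |\<in>| fst s \<or> \<phi> |\<in>| snd s) \<and>
    (\<forall>\<psi>. \<phi> = Ex \<psi> \<longrightarrow> \<phi> |\<in>| fst s \<longrightarrow> (\<exists>t. inst \<psi> t |\<in>| fst s)) \<and>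
    (\<forall>\<psi>. \<phi> = All \<psi> \<longrightarrow> \<phi> |\<in>| snd s \<longrightarrow> (\<exists>t. inst \<psi> t |\<in>| snd s))"

text \<open>By cut, one of the two ways of adding \<phi> stays unprovable. A sequent is finite, so a
  variable fresh for it can serve as Henkin witness: by the eigenvariable rule, adding the witness
  does not make the sequent provable.\<close>

lemma unprovable_decide:
  assumes "\<not> prv n s"
  shows "\<exists>s'. \<not> prv n s' \<and> fst s |\<subseteq>| fst s' \<and> snd s |\<subseteq>| snd s' \<and> decides s' \<phi>"
proof -
  obtain \<Gamma> \<Delta> where s: "s = (\<Gamma>, \<Delta>)" by fastforce
  show ?thesis
  proof (cases "prv n (finsert \<phi> \<Gamma>, \<Delta>)")
    case False
    \<comment> \<open>The clause of \<open>decides\<close> for a universal formula on the right is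
      now vacuous, since otherwise the sequent would be an axiom.\<close>
    then have *: "\<phi> |\<notin>| \<Delta>" by (auto intro: prv_ax)
    show ?thesis
    proof (cases "\<exists>\<psi>. \<phi> = Ex \<psi>")
      case True
      then obtain \<psi> where \<psi>: "\<phi> = Ex \<psi>" by blast
      \<comment> \<open>The principal formula is inserted twice: sets absorb the copy, and the
        premise of \<open>exL\<close> retains \<phi>.\<close>
      obtain y where "y \<notin> fv_seq (finsert (Ex \<psi>) (finsert \<phi> \<Gamma>), \<Delta>)"
        using ex_fresh finite_fv_seq by blast
      from prv1[OF exL[OF this]] False \<psi>
      have "\<not> prv n (finsert (inst \<psi> (Var y)) (finsert \<phi> \<Gamma>), \<Delta>)" by auto
      then show ?thesis using * \<psi> s
        by (intro exI[of _ "(finsert (inst \<psi> (Var y)) (finsert \<phi> \<Gamma>), \<Delta>)"])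
          (auto simp: decides_def)
    next
      case no: False
      then show ?thesis using * False s
        by (intro exI[of _ "(finsert \<phi> \<Gamma>, \<Delta>)"]) (auto simp: decides_def)
    qed
  next
    case True
    then have R: "\<not> prv n (\<Gamma>, finsert \<phi> \<Delta>)"
      using assms s prv2[OF cut] by blast
    then have *: "\<phi> |\<notin>| \<Gamma>" by (auto intro: prv_ax)
    show ?thesis
    proof (cases "\<exists>\<psi>. \<phi> = All \<psi>")
      case True
      then obtain \<psi> where \<psi>: "\<phi> = All \<psi>" by blast
      obtain y where "y \<notin> fv_seq (\<Gamma>, finsert (All \<psi>) (finsert \<phi> \<Delta>))"
        using ex_fresh finite_fv_seq by blast
      from prv1[OF allR[OF this]] R \<psi>
      have "\<not> prv n (\<Gamma>, finsert (inst \<psi> (Var y)) (finsert \<phi> \<Delta>))" by auto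
      then show ?thesis using * \<psi> s
        by (intro exI[of _ "(\<Gamma>, finsert (inst \<psi> (Var y)) (finsert \<phi> \<Delta>))"])
          (auto simp: decides_def)
    next
      case no: False
      then show ?thesis using * R s
        by (intro exI[of _ "(\<Gamma>, finsert \<phi> \<Delta>)"]) (auto simp: decides_def)
    qed
  qed
qed

text \<open>Having several conclusions, \<open>closed\<close> expresses deductive closure,
  consistency (empty \<open>B\<close>) and primeness at once.\<close>

locale henkin_set =
  fixes n :: nat and T :: "fm set"
  assumes closed: "prv n (A, B) \<Longrightarrow> fset A \<subseteq> T \<Longrightarrow> \<exists>\<phi>\<in>fset B. \<phi> \<in> T"
    and Ex_witness: "Ex \<phi> \<in> T \<Longrightarrow> \<exists>t. inst \<phi> t \<in> T"
    and All_witness: "All \<phi> \<notin> T \<Longrightarrow> \<exists>t. inst \<phi> t \<notin> T"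

text \<open>Compactness: finitely many members appear at a common stage of the chain.\<close>

lemma fsubset_directed_Union:
  assumes "\<And>i j :: nat. i \<le> j \<Longrightarrow> f i |\<subseteq>| f j" "fset A \<subseteq> (\<Union>i. fset (f i))"
  shows "\<exists>i. A |\<subseteq>| f i"
  using assms(2)
proof (induction A)
  case (insert a A)
  then obtain i j where "A |\<subseteq>| f i" "a |\<in>| f j" by auto
  then have "finsert a A |\<subseteq>| f (max i j)"
    using assms(1)[of i "max i j"] assms(1)[of j "max i j"] by auto
  then show ?case by blast
qed auto

lemma henkin_set_exists:
  assumes "\<not> prv n (\<Gamma>, \<Delta>)"
  obtains T where "henkin_set n T" "fset \<Gamma> \<subseteq> T" "fset \<Delta> \<inter> T = {}"
proof -
  \<comment> \<open>A chain of unprovable sequents whose step \<open>i\<close> decides the formula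
    with code \<open>i\<close>.\<close>
  have "\<exists>S. \<forall>i. (\<not> prv n (S i) \<and> (i = 0 \<longrightarrow> S i = (\<Gamma>, \<Delta>))) \<and>
      (fst (S i) |\<subseteq>| fst (S (Suc i)) \<and> snd (S i) |\<subseteq>| snd (S (Suc i)) \<and> decides (S (Suc i)) (from_nat i))"
  proof (rule dependent_nat_choice)
    show "\<exists>x. \<not> prv n x \<and> (0 = 0 \<longrightarrow> x = (\<Gamma>, \<Delta>))" using assms by blast
    show "\<exists>y. (\<not> prv n y \<and> (Suc i = 0 \<longrightarrow> y = (\<Gamma>, \<Delta>))) \<and>
      (fst x |\<subseteq>| fst y \<and> snd x |\<subseteq>| snd y \<and> decides y (from_nat i))"
      if "\<not> prv n x \<and> (i = 0 \<longrightarrow> x = (\<Gamma>, \<Delta>))" for x i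
      using unprovable_decide[of n x "from_nat i"] that by blast
  qed
  then obtain S where "\<forall>i. (\<not> prv n (S i) \<and> (i = 0 \<longrightarrow> S i = (\<Gamma>, \<Delta>))) \<and>
      (fst (S i) |\<subseteq>| fst (S (Suc i)) \<and> snd (S i) |\<subseteq>| snd (S (Suc i)) \<and> decides (S (Suc i)) (from_nat i))" ..
  then have S: "\<And>i. \<not> prv n (S i)" "S 0 = (\<Gamma>, \<Delta>)"
    "\<And>i. fst (S i) |\<subseteq>| fst (S (Suc i))" "\<And>i. snd (S i) |\<subseteq>| snd (S (Suc i))"
    "\<And>i. decides (S (Suc i)) (from_nat i)" by simp_all
  have mono: "fst (S i) |\<subseteq>| fst (S j)" "snd (S i) |\<subseteq>| snd (S j)" if "i \<le> j" for i j
    by (rule lift_Suc_mono_le[OF _ that], rule S)+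
  define T where "T = (\<Union>i. fset (fst (S i)))"
  define F where "F = (\<Union>i. fset (snd (S i)))"
  have TI: "\<phi> \<in> T" if "\<phi> |\<in>| fst (S i)" for \<phi> i using that unfolding T_def by blast
  have FI: "\<phi> \<in> F" if "\<phi> |\<in>| snd (S i)" for \<phi> i using that unfolding F_def by blast
  \<comment> \<open>A derivation from \<open>T\<close> to \<open>F\<close> uses finitely many
    formulas, so all of them occur at one stage, and weakening would prove that stage.\<close>
  have separate: False if AB: "prv n (A, B)" "fset A \<subseteq> T" "fset B \<subseteq> F" for A B
  proof -
    obtain i where "A |\<subseteq>| fst (S i)"
      using fsubset_directed_Union[of "\<lambda>i. fst (S i)" A, OF mono(1)] AB(2) unfolding T_def by blast
    moreover obtain j where "B |\<subseteq>| snd (S j)"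
      using fsubset_directed_Union[of "\<lambda>i. snd (S i)" B, OF mono(2)] AB(3) unfolding F_def by blast
    ultimately have "A |\<subseteq>| fst (S (max i j))" "B |\<subseteq>| snd (S (max i j))"
      using mono(1)[of i "max i j"] mono(2)[of j "max i j"] by auto
    then have "prv n (S (max i j))" using prv_weaken[OF AB(1)] by (metis prod.collapse)
    then show False using S(1) by blast
  qed
  have disj: "T \<inter> F = {}"
  proof (rule ccontr)
    assume "T \<inter> F \<noteq> {}"
    then obtain \<phi> where "\<phi> \<in> T" "\<phi> \<in> F" by blast
    then show False using separate[OF prv_ax[of \<phi> "{|\<phi>|}" "{|\<phi>|}"]] by simp
  qed
  have dec: "\<exists>i. decides (S i) \<phi>" for \<phi>
    using S(5)[of "to_nat \<phi>"] by auto
  have total: "\<phi> \<in> T \<or> \<phi> \<in> F" for \<phi>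
  proof -
    obtain i where "decides (S i) \<phi>" using dec by blast
    then show ?thesis using TI FI unfolding decides_def by blast
  qed
  have "henkin_set n T"
  proof
    show "\<exists>\<phi>\<in>fset B. \<phi> \<in> T" if "prv n (A, B)" "fset A \<subseteq> T" for A B
    proof (rule ccontr)
      assume "\<not> (\<exists>\<phi>\<in>fset B. \<phi> \<in> T)"
      then have "fset B \<subseteq> F" using total by blast
      then show False using separate that by blast
    qed
    show "\<exists>t. inst \<phi> t \<in> T" if "Ex \<phi> \<in> T" for \<phi>
    proof -
      obtain i where "decides (S i) (Ex \<phi>)" using dec by blast
      moreover have "Ex \<phi> |\<notin>| snd (S i)" using that disj FI by blast
      ultimately show ?thesis using TI unfolding decides_def by blast
    qed
    show "\<exists>t. inst \<phi> t \<notin> T" if "All \<phi> \<notin> T" for \<phi>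
    proof -
      obtain i where "decides (S i) (All \<phi>)" using dec by blast
      moreover have "All \<phi> |\<notin>| fst (S i)" using that TI by blast
      ultimately have "\<exists>t. inst \<phi> t \<in> F" using FI unfolding decides_def by blast
      then show ?thesis using disj by blast
    qed
  qed
  moreover have "fset \<Gamma> \<subseteq> T" "fset \<Delta> \<subseteq> F" using TI[of _ 0] FI[of _ 0] S(2) by auto
  ultimately show ?thesis using that disj by blast
qed


section \<open>Truth in a Henkin set\<close>

context henkin_set
begin

lemma closed1: "prv n (A, {|\<phi>|}) \<Longrightarrow> fset A \<subseteq> T \<Longrightarrow> \<phi> \<in> T"
  using closed[of A "{|\<phi>|}"] by simp

lemma Bot_iff: "Bot \<notin> T"
  using closed[OF prv0[OF botL[of "{||}" "{||}"]]] by auto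

lemma And_iff: "And \<phi> \<psi> \<in> T \<longleftrightarrow> \<phi> \<in> T \<and> \<psi> \<in> T"
proof
  have "prv n ({|And \<phi> \<psi>|}, {|\<phi>|})" "prv n ({|And \<phi> \<psi>|}, {|\<psi>|})"
    by (rule prv1[OF andL], (auto intro: prv_ax)[1])+
  from this[THEN closed1] show "And \<phi> \<psi> \<in> T \<Longrightarrow> \<phi> \<in> T \<and> \<psi> \<in> T" by simp
  have "prv n ({|\<phi>, \<psi>|}, {|And \<phi> \<psi>|})"
    by (rule prv2[OF andR]) (auto intro: prv_ax)
  from closed1[OF this] show "\<phi> \<in> T \<and> \<psi> \<in> T \<Longrightarrow> And \<phi> \<psi> \<in> T" by simp
qed

lemma Or_iff: "Or \<phi> \<psi> \<in> T \<longleftrightarrow> \<phi> \<in> T \<or> \<psi> \<in> T"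
proof
  have "prv n ({|Or \<phi> \<psi>|}, {|\<phi>, \<psi>|})"
    by (rule prv2[OF orL]) (auto intro: prv_ax)
  from closed[OF this] show "Or \<phi> \<psi> \<in> T \<Longrightarrow> \<phi> \<in> T \<or> \<psi> \<in> T" by simp
  have "prv n ({|\<phi>|}, {|Or \<phi> \<psi>|})" "prv n ({|\<psi>|}, {|Or \<phi> \<psi>|})"
    by (rule prv1[OF orR], (auto intro: prv_ax)[1])+
  from this[THEN closed1] show "\<phi> \<in> T \<or> \<psi> \<in> T \<Longrightarrow> Or \<phi> \<psi> \<in> T" by auto
qed

lemma Imp_iff: "Imp \<phi> \<psi> \<in> T \<longleftrightarrow> (\<phi> \<in> T \<longrightarrow> \<psi> \<in> T)"
proof
  have "prv n ({|Imp \<phi> \<psi>, \<phi>|}, {|\<psi>|})"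
    by (rule prv2[OF impL]) (auto intro: prv_ax)
  from closed1[OF this] show "Imp \<phi> \<psi> \<in> T \<Longrightarrow> \<phi> \<in> T \<longrightarrow> \<psi> \<in> T" by simp
  have "prv n ({||}, {|Imp \<phi> \<psi>, \<phi>|})"
    by (rule prv1[OF impR], (auto intro: prv_ax)[1])
  moreover have "prv n ({|\<psi>|}, {|Imp \<phi> \<psi>|})"
    by (rule prv1[OF impR], (auto intro: prv_ax)[1])
  ultimately show "\<phi> \<in> T \<longrightarrow> \<psi> \<in> T \<Longrightarrow> Imp \<phi> \<psi> \<in> T"
    using closed[of "{||}" "{|Imp \<phi> \<psi>, \<phi>|}"] closed1[of "{|\<psi>|}" "Imp \<phi> \<psi>"] by auto
qed

lemma All_iff: "All \<phi> \<in> T \<longleftrightarrow> (\<forall>t. inst \<phi> t \<in> T)"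
proof
  have "prv n ({|All \<phi>|}, {|inst \<phi> t|})" for t
    by (rule prv1[OF allL[of \<phi> t]], (auto intro: prv_ax)[1])
  from closed1[OF this] show "All \<phi> \<in> T \<Longrightarrow> \<forall>t. inst \<phi> t \<in> T" by simp
  show "\<forall>t. inst \<phi> t \<in> T \<Longrightarrow> All \<phi> \<in> T" using All_witness by blast
qed

lemma Ex_iff: "Ex \<phi> \<in> T \<longleftrightarrow> (\<exists>t. inst \<phi> t \<in> T)"
proof
  have "prv n ({|inst \<phi> t|}, {|Ex \<phi>|})" for t
    by (rule prv1[OF exR[of _ \<phi> t]], (auto intro: prv_ax)[1])
  from closed1[OF this] show "\<exists>t. inst \<phi> t \<in> T \<Longrightarrow> Ex \<phi> \<in> T" by auto
  show "Ex \<phi> \<in> T \<Longrightarrow> \<exists>t. inst \<phi> t \<in> T" by (rule Ex_witness)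
qed

section \<open>Satisfaction and equality on terms\<close>

definition eqv :: "tm \<Rightarrow> tm \<Rightarrow> bool" (infix "\<approx>" 50) where
  "s \<approx> t \<longleftrightarrow> Eq s t \<in> T"

text \<open>The terms themselves are the elements, without passing to the quotient by \<approx>;
  \<open>sat_eqv_cong\<close> makes up for this.\<close>

definition sat :: "(nat \<Rightarrow> tm) \<Rightarrow> fm \<Rightarrow> bool" where
  "sat \<rho> \<phi> \<longleftrightarrow> subst \<rho> \<phi> \<in> T"

lemma sat_simps [simp]:
  "sat \<rho> (Eq s t) \<longleftrightarrow> subst_tm \<rho> s \<approx> subst_tm \<rho> t"
  "\<not> sat \<rho> Bot"
  "sat \<rho> (And \<phi> \<psi>) \<longleftrightarrow> sat \<rho> \<phi> \<and> sat \<rho> \<psi>"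
  "sat \<rho> (Or \<phi> \<psi>) \<longleftrightarrow> sat \<rho> \<phi> \<or> sat \<rho> \<psi>"
  "sat \<rho> (Imp \<phi> \<psi>) \<longleftrightarrow> (sat \<rho> \<phi> \<longrightarrow> sat \<rho> \<psi>)"
  "sat \<rho> (All \<phi>) \<longleftrightarrow> (\<forall>a. sat (case_nat a \<rho>) \<phi>)"
  "sat \<rho> (Ex \<phi>) \<longleftrightarrow> (\<exists>a. sat (case_nat a \<rho>) \<phi>)"
  by (simp_all add: sat_def eqv_def Bot_iff And_iff Or_iff Imp_iff All_iff Ex_iff inst_subst)

lemma sat_subst: "sat \<rho> (subst \<sigma> \<phi>) \<longleftrightarrow> sat (\<lambda>k. subst_tm \<rho> (\<sigma> k)) \<phi>"
  by (simp add: sat_def subst_comp)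

lemma sat_inst: "sat \<rho> (inst \<phi> t) \<longleftrightarrow> sat (case_nat (subst_tm \<rho> t) \<rho>) \<phi>"
  by (simp add: sat_def subst_inst)

lemma sat_cong: "(\<And>k. k \<in> fv \<phi> \<Longrightarrow> \<rho> k = \<rho>' k) \<Longrightarrow> sat \<rho> \<phi> \<longleftrightarrow> sat \<rho>' \<phi>"
  unfolding sat_def using subst_cong[of \<phi> \<rho> \<rho>'] by simp

lemma eqv_refl: "t \<approx> t"
  unfolding eqv_def using closed1[OF prv0[OF eqR]] by simp

text \<open>Rule \<open>eqL\<close> is applied to \<phi>(x) \<Rightarrow> \<phi>(t) with fresh
  \<open>x\<close> and \<open>y\<close>. The conclusion is s = t, \<phi>(s) \<Rightarrow> \<phi>(t),
  and the premise is the axiom \<phi>(t) \<Rightarrow> \<phi>(t).\<close>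

lemma Leibniz:
  assumes "s \<approx> t" "inst \<phi> s \<in> T"
  shows "inst \<phi> t \<in> T"
proof -
  let ?A = "fv_tm t \<union> fv (All \<phi>)"
  obtain x where x: "x \<notin> ?A" using ex_fresh[of ?A] finite_fv[of "All \<phi>"] finite_fv_tm[of t] by auto
  obtain y where y: "y \<notin> insert x ?A"
    using ex_fresh[of "insert x ?A"] finite_fv[of "All \<phi>"] finite_fv_tm[of t] by auto
  have cong: "subst (case_nat w (Var(x := u, y := v))) \<phi> = inst \<phi> w" for u v w
    unfolding inst_def
  proof (rule subst_cong)
    show "case_nat w (Var(x := u, y := v)) k = case_nat w Var k" if "k \<in> fv \<phi>" for k
      using that x y by (cases k) auto
  qed
  have t: "subst_tm (Var(x := u, y := v)) t = t" for u v
  proof -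
    have "subst_tm (Var(x := u, y := v)) t = subst_tm Var t"
      using x y by (intro subst_tm_cong) auto
    then show ?thesis by simp
  qed
  have xy: "x \<noteq> y" using y by auto
  have 1: "subst (Var(x := u, y := v)) (inst \<phi> (Var x)) = inst \<phi> u" for u v
    using xy by (simp add: subst_inst cong)
  have 2: "subst (Var(x := u, y := v)) (inst \<phi> t) = inst \<phi> t" for u v
    by (simp add: subst_inst t cong)
  have "prv n (finsert (Eq s t) {|inst \<phi> s|}, {|inst \<phi> t|})"
  proof (rule prv1[OF eqL, OF xy])
    show "subst_seq (Var(x := s, y := t)) ({|inst \<phi> (Var x)|}, {|inst \<phi> t|}) = ({|inst \<phi> s|}, {|inst \<phi> t|})"
      by (simp add: subst_seq_def 1 2)
    show "prv n (subst_seq (Var(x := t, y := s)) ({|inst \<phi> (Var x)|}, {|inst \<phi> t|}))"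
      by (simp add: subst_seq_def 1 2 prv_ax)
  qed
  then show ?thesis by (rule closed1) (use assms in \<open>auto simp: eqv_def\<close>)
qed

lemma shift_tm_inst [simp]: "subst_tm (case_nat t Var) (shift_tm s) = s"
  by (simp add: subst_tm_shift)

text \<open>This and the congruences below apply \<open>Leibniz\<close> to an equation that holds by
  reflexivity, with index 0 at the place to be rewritten and the parameters shifted past it.\<close>

lemma eqv_sym: "s \<approx> t \<Longrightarrow> t \<approx> s"
  using Leibniz[of s t "Eq (Var 0) (shift_tm s)"] eqv_refl[of s] by (simp add: inst_def eqv_def)

lemma eqv_trans: "r \<approx> s \<Longrightarrow> s \<approx> t \<Longrightarrow> r \<approx> t"
  using Leibniz[of s t "Eq (shift_tm r) (Var 0)"] by (simp add: inst_def eqv_def)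

lemma eqv_Succ: "s \<approx> t \<Longrightarrow> Succ s \<approx> Succ t"
  using Leibniz[of s t "Eq (Succ (shift_tm s)) (Succ (Var 0))"] eqv_refl[of "Succ s"]
  by (simp add: inst_def eqv_def)

lemma eqv_Add:
  assumes "s \<approx> t" "s' \<approx> t'"
  shows "Add s s' \<approx> Add t t'"
  using Leibniz[OF assms(1), of "Eq (shift_tm (Add s s')) (Add (Var 0) (shift_tm s'))"]
    Leibniz[OF assms(2), of "Eq (shift_tm (Add s s')) (Add (shift_tm t) (Var 0))"] eqv_refl[of "Add s s'"]
  by (simp add: inst_def eqv_def)

lemma eqv_Mul:
  assumes "s \<approx> t" "s' \<approx> t'"
  shows "Mul s s' \<approx> Mul t t'"
  using Leibniz[OF assms(1), of "Eq (shift_tm (Mul s s')) (Mul (Var 0) (shift_tm s'))"]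
    Leibniz[OF assms(2), of "Eq (shift_tm (Mul s s')) (Mul (shift_tm t) (Var 0))"] eqv_refl[of "Mul s s'"]
  by (simp add: inst_def eqv_def)

lemma eqv_subst_tm: "(\<And>k. \<sigma> k \<approx> \<tau> k) \<Longrightarrow> subst_tm \<sigma> t \<approx> subst_tm \<tau> t"
  by (induction t) (simp_all add: eqv_refl eqv_Succ eqv_Add eqv_Mul)

lemma sat_eqv_cong: "(\<And>k. \<rho> k \<approx> \<rho>' k) \<Longrightarrow> sat \<rho> \<phi> \<longleftrightarrow> sat \<rho>' \<phi>"
proof (induction \<phi> arbitrary: \<rho> \<rho>')
  case (Eq s t)
  have "subst_tm \<rho> s \<approx> subst_tm \<rho>' s" "subst_tm \<rho> t \<approx> subst_tm \<rho>' t"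
    by (rule eqv_subst_tm, rule Eq)+
  then show ?case unfolding sat_simps by (meson eqv_sym eqv_trans)
next
  case (And \<phi> \<psi>)
  show ?case using And.IH(1)[OF And.prems] And.IH(2)[OF And.prems] by simp
next
  case (Or \<phi> \<psi>)
  show ?case using Or.IH(1)[OF Or.prems] Or.IH(2)[OF Or.prems] by simp
next
  case (Imp \<phi> \<psi>)
  show ?case using Imp.IH(1)[OF Imp.prems] Imp.IH(2)[OF Imp.prems] by simp
next
  case (All \<phi>)
  have "sat (case_nat a \<rho>) \<phi> \<longleftrightarrow> sat (case_nat a \<rho>') \<phi>" for a
    by (rule All.IH) (auto simp: eqv_refl All.prems split: nat.split)
  then show ?case by simp
next
  case (Ex \<phi>)
  have "sat (case_nat a \<rho>) \<phi> \<longleftrightarrow> sat (case_nat a \<rho>') \<phi>" for a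
    by (rule Ex.IH) (auto simp: eqv_refl Ex.prems split: nat.split)
  then show ?case by simp
qed simp

lemma Succ_eqv_SuccD: "Succ s \<approx> Succ t \<Longrightarrow> s \<approx> t"
  using closed1[OF prv0[OF succ_inj[of s t]]] by (simp add: eqv_def)

lemma not_Succ_eqv_Zero: "\<not> Succ t \<approx> Zero"
  using closed1[OF prv0[OF zero_neq_succ[of t]]] eqv_sym[of "Succ t" Zero]
  by (auto simp: eqv_def Imp_iff Bot_iff)

lemma Add_Zero_eqv: "Add s Zero \<approx> s"
  using closed1[OF prv0[OF add_zero[of s]]] by (simp add: eqv_def)

lemma Add_Succ_eqv: "Add s (Succ t) \<approx> Succ (Add s t)"
  using closed1[OF prv0[OF add_succ[of s t]]] by (simp add: eqv_def)

section \<open>Truth of sequents and local soundness\<close>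

definition tru :: "(nat \<Rightarrow> tm) \<Rightarrow> sequent \<Rightarrow> bool" where
  "tru \<rho> c \<longleftrightarrow> (\<forall>\<phi>\<in>fset (fst c). sat \<rho> \<phi>) \<longrightarrow> (\<exists>\<phi>\<in>fset (snd c). sat \<rho> \<phi>)"

lemma tru_cong:
  assumes "\<And>k. k \<in> fv_seq c \<Longrightarrow> \<rho> k = \<rho>' k"
  shows "tru \<rho> c \<longleftrightarrow> tru \<rho>' c"
proof -
  have "sat \<rho> \<phi> \<longleftrightarrow> sat \<rho>' \<phi>" if "\<phi> \<in> fset (fst c) \<union> fset (snd c)" for \<phi>
    by (rule sat_cong, rule assms) (use that in \<open>auto simp: fv_seq_def fv_fset_def\<close>)
  then show ?thesis unfolding tru_def by blast
qed

lemma tru_eqv_cong: "(\<And>k. \<rho> k \<approx> \<rho>' k) \<Longrightarrow> tru \<rho> c \<longleftrightarrow> tru \<rho>' c"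
  unfolding tru_def using sat_eqv_cong[of \<rho> \<rho>'] by simp

lemma tru_subst: "tru \<rho> (subst_seq \<sigma> c) \<longleftrightarrow> tru (\<lambda>k. subst_tm \<rho> (\<sigma> k)) c"
  by (simp add: tru_def subst_seq_def sat_subst)

text \<open>Local soundness, read from the conclusion to the premises. Only an eigenvariable may
  change its value, and it is not free in the conclusion, so values can be traced along a branch.
  For axioms the claim is that the conclusion cannot be false.\<close>

lemma common_rule_step:
  assumes "common_rule ps c" "\<not> tru \<rho> c"
  shows "\<exists>p\<in>set ps. \<exists>\<rho>'. \<not> tru \<rho>' p \<and> (\<forall>z\<in>fv_seq c. \<rho>' z = \<rho> z)"
  using assms
proof (cases rule: common_rule.cases)
  case (allR y \<Gamma> \<phi> \<Delta>)
  then obtain a where a: "\<not> sat (case_nat a \<rho>) \<phi>" using assms(2) by (auto simp: tru_def)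
  let ?\<rho> = "\<rho>(y := a)"
  have agree: "\<forall>z\<in>fv_seq c. ?\<rho> z = \<rho> z" using allR by auto
  have "sat (case_nat a ?\<rho>) \<phi> \<longleftrightarrow> sat (case_nat a \<rho>) \<phi>"
    by (rule sat_cong) (use allR in \<open>auto simp: fv_seq_def fv_fset_def split: nat.split\<close>)
  then have "\<not> sat ?\<rho> (inst \<phi> (Var y))" using a by (simp add: sat_inst)
  moreover have "\<not> tru ?\<rho> c" using tru_cong[of c ?\<rho> \<rho>] agree assms(2) by blast
  ultimately have "\<not> tru ?\<rho> (\<Gamma>, finsert (inst \<phi> (Var y)) \<Delta>)" using allR by (auto simp: tru_def)
  then show ?thesis using agree allR by auto
next
  case (exL y \<phi> \<Gamma> \<Delta>)
  then obtain a where a: "sat (case_nat a \<rho>) \<phi>" using assms(2) by (auto simp: tru_def)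
  let ?\<rho> = "\<rho>(y := a)"
  have agree: "\<forall>z\<in>fv_seq c. ?\<rho> z = \<rho> z" using exL by auto
  have "sat (case_nat a ?\<rho>) \<phi> \<longleftrightarrow> sat (case_nat a \<rho>) \<phi>"
    by (rule sat_cong) (use exL in \<open>auto simp: fv_seq_def fv_fset_def split: nat.split\<close>)
  then have "sat ?\<rho> (inst \<phi> (Var y))" using a by (simp add: sat_inst)
  moreover have "\<not> tru ?\<rho> c" using tru_cong[of c ?\<rho> \<rho>] agree assms(2) by blast
  ultimately have "\<not> tru ?\<rho> (finsert (inst \<phi> (Var y)) \<Gamma>, \<Delta>)" using exL by (auto simp: tru_def)
  then show ?thesis using agree exL by auto
next
  case (eqL x y s t \<Gamma> \<Delta> \<Gamma>' \<Delta>')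
  have st: "subst_tm \<rho> s \<approx> subst_tm \<rho> t" using eqL assms(2) by (auto simp: tru_def)
  have "\<not> tru \<rho> (subst_seq (Var(x := s, y := t)) (\<Gamma>, \<Delta>))"
    using eqL assms(2) by (auto simp: tru_def)
  \<comment> \<open>The two substitutions differ by exchanging \<open>s\<close> and
    \<open>t\<close>, which have equal values.\<close>
  moreover have "tru (\<lambda>k. subst_tm \<rho> ((Var(x := s, y := t)) k)) (\<Gamma>, \<Delta>) \<longleftrightarrow>
      tru (\<lambda>k. subst_tm \<rho> ((Var(x := t, y := s)) k)) (\<Gamma>, \<Delta>)"
    by (rule tru_eqv_cong) (auto simp: st eqv_sym eqv_refl)
  ultimately have "\<not> tru \<rho> (subst_seq (Var(x := t, y := s)) (\<Gamma>, \<Delta>))" by (simp add: tru_subst)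
  then show ?thesis using eqL by auto
next
  case (allL \<phi> t \<Gamma> \<Delta>)
  then have "\<not> tru \<rho> (finsert (inst \<phi> t) \<Gamma>, \<Delta>)" using assms(2) by (auto simp: tru_def sat_inst)
  then show ?thesis using allL by auto
next
  case (exR \<Gamma> \<phi> t \<Delta>)
  then have "\<not> tru \<rho> (\<Gamma>, finsert (inst \<phi> t) \<Delta>)" using assms(2) by (auto simp: tru_def sat_inst)
  then show ?thesis using exR by auto
next
  case (weakening \<Gamma> \<Gamma>' \<Delta> \<Delta>')
  then have "\<not> tru \<rho> (\<Gamma>, \<Delta>)" using assms(2) by (auto simp: tru_def)
  then show ?thesis using weakening by auto
next
  case (zero_neq_succ t)
  then show ?thesis using assms(2) not_Succ_eqv_Zero eqv_sym by (auto simp: tru_def)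
next
  case (succ_inj s t)
  then show ?thesis using assms(2) Succ_eqv_SuccD by (auto simp: tru_def)
next
  case (mul_zero s)
  then show ?thesis using assms(2) closed1[OF prv0[OF common_rule.mul_zero]]
    by (simp add: tru_def eqv_def)
next
  case (mul_succ s t)
  then show ?thesis using assms(2) closed1[OF prv0[OF common_rule.mul_succ]]
    by (simp add: tru_def eqv_def)
qed (use assms(2) in \<open>auto simp: tru_def eqv_refl Add_Zero_eqv Add_Succ_eqv\<close>)

end


section \<open>Definable predicates on valuations\<close>

text \<open>Peels off only the outer universal block and stays at one level, unlike the mutual
  induction over both hierarchies.\<close>

lemma Pi_fm_Suc_induct [consumes 1, case_names Sigma All]:
  assumes "Pi_fm (Suc m) \<phi>"
    and "\<And>\<phi>. Sigma_fm m \<phi> \<Longrightarrow> P \<phi>"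
    and "\<And>\<phi>. Pi_fm (Suc m) \<phi> \<Longrightarrow> P \<phi> \<Longrightarrow> P (All \<phi>)"
  shows "P \<phi>"
  using assms(1)
proof (induction \<phi> rule: measure_induct_rule[of size])
  case (less \<phi>)
  from less.prems show ?case
    by (cases rule: Pi_fm.cases) (use assms(2,3) less.IH in auto)
qed

context henkin_set
begin

text \<open>Predicates on valuations instead of formulas: at positive levels the syntactic classes
  demand a quantifier prefix and are not closed under conjunction and disjunction, whereas the
  predicates they define over \<open>T\<close> are.\<close>

definition PiD :: "nat \<Rightarrow> ((nat \<Rightarrow> tm) \<Rightarrow> bool) \<Rightarrow> bool" where
  "PiD m P \<longleftrightarrow> (\<exists>\<phi>. Pi_fm m \<phi> \<and> P = (\<lambda>\<rho>. sat \<rho> \<phi>))"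

definition SigmaD :: "nat \<Rightarrow> ((nat \<Rightarrow> tm) \<Rightarrow> bool) \<Rightarrow> bool" where
  "SigmaD m P \<longleftrightarrow> (\<exists>\<phi>. Sigma_fm m \<phi> \<and> P = (\<lambda>\<rho>. sat \<rho> \<phi>))"

lemma PiD_fm: "Pi_fm m \<phi> \<Longrightarrow> PiD m (\<lambda>\<rho>. sat \<rho> \<phi>)"
  unfolding PiD_def by blast

lemma SigmaD_fm: "Sigma_fm m \<phi> \<Longrightarrow> SigmaD m (\<lambda>\<rho>. sat \<rho> \<phi>)"
  unfolding SigmaD_def by blast

lemma PiD_bounded: "bounded_fm \<phi> \<Longrightarrow> PiD m (\<lambda>\<rho>. sat \<rho> \<phi>)"
  by (intro PiD_fm bounded_imp_Pi_fm)

lemma PiD_0_iff_SigmaD_0: "PiD 0 P \<longleftrightarrow> SigmaD 0 P"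
proof -
  have "Pi_fm 0 \<phi> \<longleftrightarrow> bounded_fm \<phi>" "Sigma_fm 0 \<phi> \<longleftrightarrow> bounded_fm \<phi>" for \<phi>
    by (auto intro: Sigma_fm_Pi_fm.intros elim: Pi_fm.cases Sigma_fm.cases)
  then show ?thesis by (simp add: PiD_def SigmaD_def)
qed

lemma PiD_Suc: "PiD m P \<Longrightarrow> PiD (Suc m) P"
  unfolding PiD_def using Sigma_Pi_fm_Suc(2) by blast

lemma SigmaD_imp_PiD_Suc: "SigmaD m P \<Longrightarrow> PiD (Suc m) P"
  unfolding PiD_def SigmaD_def using Sigma_fm_Pi_fm.intros(5) by blast

lemma PiD_imp_SigmaD_Suc: "PiD m P \<Longrightarrow> SigmaD (Suc m) P"
  unfolding PiD_def SigmaD_def using Sigma_fm_Pi_fm.intros(2) by blast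

section \<open>Closure properties of the definable predicates\<close>

lemma PiD_subst:
  assumes "PiD m P"
  shows "PiD m (\<lambda>\<rho>. P (\<lambda>k. subst_tm \<rho> (\<sigma> k)))"
proof -
  obtain \<phi> where "Pi_fm m \<phi>" "P = (\<lambda>\<rho>. sat \<rho> \<phi>)" using assms by (auto simp: PiD_def)
  then show ?thesis using PiD_fm[OF Sigma_Pi_fm_subst(2), of m \<phi> \<sigma>] by (simp add: sat_subst)
qed

lemma SigmaD_subst:
  assumes "SigmaD m P"
  shows "SigmaD m (\<lambda>\<rho>. P (\<lambda>k. subst_tm \<rho> (\<sigma> k)))"
proof -
  obtain \<phi> where "Sigma_fm m \<phi>" "P = (\<lambda>\<rho>. sat \<rho> \<phi>)" using assms by (auto simp: SigmaD_def)
  then show ?thesis using SigmaD_fm[OF Sigma_Pi_fm_subst(1), of m \<phi> \<sigma>] by (simp add: sat_subst)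
qed

lemma PiD_All:
  assumes "PiD (Suc m) P"
  shows "PiD (Suc m) (\<lambda>\<rho>. \<forall>a. P (case_nat a \<rho>))"
proof -
  obtain \<phi> where "Pi_fm (Suc m) \<phi>" "P = (\<lambda>\<rho>. sat \<rho> \<phi>)" using assms by (auto simp: PiD_def)
  then show ?thesis using PiD_fm[OF Sigma_fm_Pi_fm.intros(6), of m \<phi>] by simp
qed

lemma SigmaD_Ex:
  assumes "SigmaD (Suc m) P"
  shows "SigmaD (Suc m) (\<lambda>\<rho>. \<exists>a. P (case_nat a \<rho>))"
proof -
  obtain \<phi> where "Sigma_fm (Suc m) \<phi>" "P = (\<lambda>\<rho>. sat \<rho> \<phi>)" using assms by (auto simp: SigmaD_def)
  then show ?thesis using SigmaD_fm[OF Sigma_fm_Pi_fm.intros(3), of m \<phi>] by simp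
qed

lemma PiD_Suc_induct [consumes 1, case_names Sigma All]:
  assumes "PiD (Suc m) P"
    and "\<And>R. SigmaD m R \<Longrightarrow> Q R"
    and "\<And>R. PiD (Suc m) R \<Longrightarrow> Q R \<Longrightarrow> Q (\<lambda>\<rho>. \<forall>a. R (case_nat a \<rho>))"
  shows "Q P"
proof -
  obtain \<phi> where \<phi>: "Pi_fm (Suc m) \<phi>" "P = (\<lambda>\<rho>. sat \<rho> \<phi>)" using assms(1) by (auto simp: PiD_def)
  have "Q (\<lambda>\<rho>. sat \<rho> \<phi>)"
    using \<phi>(1)
  proof (induction rule: Pi_fm_Suc_induct)
    case (Sigma \<phi>)
    then show ?case using assms(2) by (auto simp: SigmaD_def)
  next
    case (All \<phi>)
    then show ?case using assms(3)[OF PiD_fm[OF All(1)]] by simp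
  qed
  then show ?thesis by (simp add: \<phi>(2))
qed

text \<open>Negation passes through the prefix, dualising each quantifier, down to the bounded
  matrix, where \<open>Imp \<phi> Bot\<close> is again bounded.\<close>

lemma neg_fm:
  "Sigma_fm m \<phi> \<Longrightarrow> PiD m (\<lambda>\<rho>. \<not> sat \<rho> \<phi>)"
  "Pi_fm m \<phi> \<Longrightarrow> SigmaD m (\<lambda>\<rho>. \<not> sat \<rho> \<phi>)"
proof (induction rule: Sigma_fm_Pi_fm.inducts)
  case (1 \<phi>)
  then show ?case using PiD_bounded[of "Imp \<phi> Bot" 0] by (simp add: bounded_fm.intros)
next
  case (2 m \<phi>)
  then show ?case by (intro SigmaD_imp_PiD_Suc)
next
  case (3 m \<phi>)
  then show ?case using PiD_All by fastforce
next
  case (4 \<phi>)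
  then show ?case
    using PiD_bounded[of "Imp \<phi> Bot" 0] by (simp add: bounded_fm.intros PiD_0_iff_SigmaD_0)
next
  case (5 m \<phi>)
  then show ?case by (intro PiD_imp_SigmaD_Suc)
next
  case (6 m \<phi>)
  then show ?case using SigmaD_Ex by fastforce
qed

lemma PiD_neg: "SigmaD m P \<Longrightarrow> PiD m (\<lambda>\<rho>. \<not> P \<rho>)"
  unfolding SigmaD_def using neg_fm(1) by blast

lemma SigmaD_neg: "PiD m P \<Longrightarrow> SigmaD m (\<lambda>\<rho>. \<not> P \<rho>)"
  unfolding PiD_def using neg_fm(2) by blast

text \<open>Prenexing, with \<open>f\<close> standing for conjunction or disjunction: the universal
  blocks are moved to the front one quantifier at a time until two \<Sigma>_m predicates
  remain.\<close>

lemma PiD_Suc_binary: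
  assumes "PiD (Suc m) P" "PiD (Suc m) Q"
    and Sigma: "\<And>P Q. SigmaD m P \<Longrightarrow> SigmaD m Q \<Longrightarrow> SigmaD m (\<lambda>\<rho>. f (P \<rho>) (Q \<rho>))"
    and commute: "\<And>p q. f p q = f q p"
    and distrib: "\<And>p q. f p (\<forall>a::tm. q a) = (\<forall>a. f p (q a))"
  shows "PiD (Suc m) (\<lambda>\<rho>. f (P \<rho>) (Q \<rho>))"
proof -
  have mixed: "PiD (Suc m) (\<lambda>\<rho>. f (P \<rho>) (Q \<rho>))" if "PiD (Suc m) Q" "SigmaD m P" for P Q
    using that
  proof (induction arbitrary: P rule: PiD_Suc_induct)
    case (Sigma Q)
    then show ?case by (intro SigmaD_imp_PiD_Suc assms(3))
  next
    case (All Q)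
    \<comment> \<open>Shifting the indices keeps \<open>P\<close> clear of the variable bound by the
      moved quantifier.\<close>
    have "SigmaD m (\<lambda>\<rho>. P (\<lambda>k. \<rho> (Suc k)))"
      using SigmaD_subst[OF All.prems, of "\<lambda>k. Var (Suc k)"] by simp
    from PiD_All[OF All.IH[OF this]] show ?case by (simp add: distrib)
  qed
  show ?thesis
    using assms(1,2)
  proof (induction arbitrary: Q rule: PiD_Suc_induct)
    case (Sigma P)
    then show ?case by (intro mixed)
  next
    case (All P)
    have "PiD (Suc m) (\<lambda>\<rho>. Q (\<lambda>k. \<rho> (Suc k)))"
      using PiD_subst[OF All.prems, of "\<lambda>k. Var (Suc k)"] by simp
    from PiD_All[OF All.IH[OF this]] show ?case
      by (simp add: distrib[symmetric] commute[of _ "Q _"])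
  qed
qed

text \<open>Both connectives are treated together because passing between \<Pi>_m and \<Sigma>_m by
  negation exchanges them.\<close>

lemma PiD_disj_conj:
  assumes "PiD m P" "PiD m Q"
  shows "PiD m (\<lambda>\<rho>. P \<rho> \<or> Q \<rho>) \<and> PiD m (\<lambda>\<rho>. P \<rho> \<and> Q \<rho>)"
  using assms
proof (induction m arbitrary: P Q)
  case 0
  then obtain \<phi> \<psi> where "Pi_fm 0 \<phi>" "P = (\<lambda>\<rho>. sat \<rho> \<phi>)" "Pi_fm 0 \<psi>" "Q = (\<lambda>\<rho>. sat \<rho> \<psi>)"
    by (auto simp: PiD_def)
  moreover from this have "bounded_fm \<phi>" "bounded_fm \<psi>" by (auto elim: Pi_fm.cases)
  ultimately show ?case
    using PiD_bounded[of "Or \<phi> \<psi>" 0] PiD_bounded[of "And \<phi> \<psi>" 0] by (simp add: bounded_fm.intros)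
next
  case (Suc m)
  have "SigmaD m (\<lambda>\<rho>. P \<rho> \<or> Q \<rho>) \<and> SigmaD m (\<lambda>\<rho>. P \<rho> \<and> Q \<rho>)"
    if "SigmaD m P" "SigmaD m Q" for P Q
    using Suc.IH[OF PiD_neg[OF that(1)] PiD_neg[OF that(2)]]
      SigmaD_neg[of m "\<lambda>\<rho>. \<not> P \<rho> \<and> \<not> Q \<rho>"] SigmaD_neg[of m "\<lambda>\<rho>. \<not> P \<rho> \<or> \<not> Q \<rho>"] by simp
  then show ?case
    using PiD_Suc_binary[OF Suc.prems, of "(\<or>)"] PiD_Suc_binary[OF Suc.prems, of "(\<and>)"]
    by (simp add: disj_commute conj_commute)
qed

lemma PiD_const: "PiD m (\<lambda>\<rho>. b)"
  using PiD_bounded[of Bot m] PiD_bounded[of "Imp Bot Bot" m]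
  by (cases b) (simp_all add: bounded_fm.intros)

lemma PiD_Ball: "finite A \<Longrightarrow> (\<And>a. a \<in> A \<Longrightarrow> PiD m (P a)) \<Longrightarrow> PiD m (\<lambda>\<rho>. \<forall>a\<in>A. P a \<rho>)"
  by (induction rule: finite_induct) (simp_all add: PiD_const PiD_disj_conj)

lemma PiD_Bex: "finite A \<Longrightarrow> (\<And>a. a \<in> A \<Longrightarrow> PiD m (P a)) \<Longrightarrow> PiD m (\<lambda>\<rho>. \<exists>a\<in>A. P a \<rho>)"
  by (induction rule: finite_induct) (simp_all add: PiD_const PiD_disj_conj)

lemma PiD_all_at:
  assumes "PiD (Suc m) P"
  shows "PiD (Suc m) (\<lambda>\<rho>. \<forall>a. P (\<rho>(y := a)))"
proof -
  have "(\<lambda>k. subst_tm (case_nat a \<rho>) (if k = y then Var 0 else Var (Suc k))) = \<rho>(y := a)" for a \<rho>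
    by auto
  then show ?thesis
    using PiD_All[OF PiD_subst[OF assms, of "\<lambda>k. if k = y then Var 0 else Var (Suc k)"]] by simp
qed

text \<open>An induction hypothesis has to cover all values of the variables that change along a
  walk. Finitely many are involved, and quantifying over them universally keeps the level.\<close>

lemma PiD_all_on:
  assumes "finite W" "PiD (Suc m) P"
  shows "PiD (Suc m) (\<lambda>\<rho>. \<forall>\<rho>'. (\<forall>z. z \<notin> W \<longrightarrow> \<rho>' z = \<rho> z) \<longrightarrow> P \<rho>')"
  using assms(1)
proof (induction rule: finite_induct)
  case empty
  have "(\<forall>\<rho>'. (\<forall>z. z \<notin> {} \<longrightarrow> \<rho>' z = \<rho> z) \<longrightarrow> P \<rho>') = P \<rho>" for \<rho>
    by (simp flip: fun_eq_iff)
  then show ?case using assms(2) by (simp only:)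
next
  case (insert y W)
  have "(\<forall>a. \<forall>\<rho>'. (\<forall>z. z \<notin> W \<longrightarrow> \<rho>' z = (\<rho>(y := a)) z) \<longrightarrow> P \<rho>') \<longleftrightarrow>
      (\<forall>\<rho>'. (\<forall>z. z \<notin> insert y W \<longrightarrow> \<rho>' z = \<rho> z) \<longrightarrow> P \<rho>')" (is "?L \<longleftrightarrow> ?R") for \<rho>
  proof
    assume ?L
    show ?R
    proof (intro allI impI)
      fix \<rho>' assume "\<forall>z. z \<notin> insert y W \<longrightarrow> \<rho>' z = \<rho> z"
      then have "\<forall>z. z \<notin> W \<longrightarrow> \<rho>' z = (\<rho>(y := \<rho>' y)) z" by simp
      with \<open>?L\<close> show "P \<rho>'" by blast
    qed
  next
    assume ?R
    then show ?L using insert.hyps by auto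
  qed
  then show ?case using PiD_all_at[OF insert.IH, of y] by simp
qed

text \<open>Antecedents count negatively and become \<Sigma>_m; together with the \<Pi>_m succedents
  this leads to level m+1.\<close>

lemma PiD_tru:
  assumes "Pi_seq m c"
  shows "PiD (Suc m) (\<lambda>\<rho>. tru \<rho> c)"
proof -
  have "PiD (Suc m) (\<lambda>\<rho>. \<exists>\<phi>\<in>fset (fst c). \<not> sat \<rho> \<phi>)"
    using assms by (intro PiD_Bex SigmaD_imp_PiD_Suc neg_fm(2)) (auto simp: Pi_seq_def)
  moreover have "PiD (Suc m) (\<lambda>\<rho>. \<exists>\<phi>\<in>fset (snd c). sat \<rho> \<phi>)"
    using assms by (intro PiD_Bex PiD_Suc PiD_fm) (auto simp: Pi_seq_def)
  ultimately have "PiD (Suc m) (\<lambda>\<rho>. (\<exists>\<phi>\<in>fset (fst c). \<not> sat \<rho> \<phi>) \<or> (\<exists>\<phi>\<in>fset (snd c). sat \<rho> \<phi>))"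
    by (simp add: PiD_disj_conj)
  moreover have "(\<lambda>\<rho>. tru \<rho> c) =
      (\<lambda>\<rho>. (\<exists>\<phi>\<in>fset (fst c). \<not> sat \<rho> \<phi>) \<or> (\<exists>\<phi>\<in>fset (snd c). sat \<rho> \<phi>))"
    by (auto simp: tru_def)
  ultimately show ?thesis by simp
qed

section \<open>Induction inside \<open>T\<close>\<close>

lemma PiD_induct:
  assumes "PiD (Suc n) P" "P (\<rho>(x := Zero))" "\<And>a. P (\<rho>(x := a)) \<Longrightarrow> P (\<rho>(x := Succ a))"
  shows "P (\<rho>(x := a))"
proof -
  obtain \<phi> where \<phi>: "Pi_fm (Suc n) \<phi>" "P = (\<lambda>\<rho>. sat \<rho> \<phi>)" using assms(1) by (auto simp: PiD_def)
  \<comment> \<open>All variables except \<open>x\<close> are replaced by their values under \<rho>,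
    so the parameters enter the induction formula as terms.\<close>
  define \<psi> where "\<psi> = subst (\<lambda>k. if k = x then Var 0 else shift_tm (\<rho> k)) \<phi>"
  have "(\<lambda>k. subst_tm (case_nat b Var) (if k = x then Var 0 else shift_tm (\<rho> k))) = \<rho>(x := b)" for b
    by auto
  then have inst: "inst \<psi> b \<in> T \<longleftrightarrow> P (\<rho>(x := b))" for b
    unfolding \<psi>_def \<phi>(2) sat_def by (simp add: inst_def subst_comp)
  have "inst (subst (Var(0 := Succ (Var 0))) \<psi>) b = inst \<psi> (Succ b)" for b
    unfolding inst_def subst_comp by (intro subst_cong) (auto split: nat.split)
  then have "inst (Imp \<psi> (subst (Var(0 := Succ (Var 0))) \<psi>)) b \<in> T" for b
    using assms(3)[of b] inst by (simp add: inst_def Imp_iff)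
  then have step: "All (Imp \<psi> (subst (Var(0 := Succ (Var 0))) \<psi>)) \<in> T" by (simp add: All_iff)
  have "Pi_fm (Suc n) \<psi>" unfolding \<psi>_def using \<phi>(1) by (rule Sigma_Pi_fm_subst(2))
  from closed1[OF prv.induction[OF this]] show ?thesis using step assms(2) inst by simp
qed

text \<open>Induction in \<open>T\<close>, with the predecessor sought below the element itself:
  this keeps the induction formula bounded, hence \<Pi>_{n+1} even for n = 0.\<close>

lemma Zero_or_Succ: "a \<approx> Zero \<or> (\<exists>b. a \<approx> Succ b)"
proof -
  have Less: "sat \<rho> (Less s t) \<longleftrightarrow> (\<exists>c. Add (subst_tm \<rho> s) (Succ c) \<approx> subst_tm \<rho> t)" for \<rho> s t
    by (simp add: Less_def subst_tm_shift)
  define \<phi> where "\<phi> = Or (Eq (Var 0) Zero)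
    (Ex (And (Less (Var 0) (shift_tm (Var 0))) (Eq (Var (Suc 0)) (Succ (Var 0)))))"
  have sat: "sat \<rho> \<phi> \<longleftrightarrow> \<rho> 0 \<approx> Zero \<or> (\<exists>b. (\<exists>c. Add b (Succ c) \<approx> \<rho> 0) \<and> \<rho> 0 \<approx> Succ b)" for \<rho>
    by (simp add: \<phi>_def Less subst_tm_shift)
  have "bounded_fm \<phi>" unfolding \<phi>_def by (intro bounded_fm.intros)
  then have def: "PiD (Suc n) (\<lambda>\<rho>. sat \<rho> \<phi>)" by (rule PiD_bounded)
  have "Add b (Succ Zero) \<approx> Succ b" for b
    using eqv_trans[OF Add_Succ_eqv eqv_Succ[OF Add_Zero_eqv]] .
  then have succ: "sat (\<rho>(0 := Succ b)) \<phi>" for \<rho> b unfolding sat using eqv_refl by auto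
  have zero: "sat (\<rho>(0 := Zero)) \<phi>" for \<rho> by (simp add: sat eqv_refl)
  have "sat (\<rho>(0 := a)) \<phi>" for \<rho>
    by (rule PiD_induct[OF def zero succ])
  then show ?thesis unfolding sat by auto
qed

lemma Succ_pow_eqv: "b \<approx> c \<Longrightarrow> (Succ ^^ k) b \<approx> (Succ ^^ k) c"
  by (induction k) (auto intro: eqv_Succ)

text \<open>
  Several decreasing edges may lie between two buds, so the induction must look back further than one
  step. As their number is at most the height of the tree, a standard bound \<open>h\<close> on the look-back
  suffices, and the order of \<open>T\<close> is not needed.
\<close>

lemma PiD_bounded_course_induct:
  assumes P: "PiD (Suc n) P"
    and step: "\<And>a. (\<And>k b. 1 \<le> k \<Longrightarrow> k \<le> h \<Longrightarrow> (Succ ^^ k) b \<approx> a \<Longrightarrow> P (\<rho>(x := b))) \<Longrightarrow> P (\<rho>(x := a))"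
  shows "P (\<rho>(x := a))"
proof -
  \<comment> \<open>\<open>Q\<close> covers the present value (\<open>k = 0\<close>) and the
    \<open>h\<close> values before it, so that plain induction on \<open>Q\<close> suffices.\<close>
  define Q where "Q = (\<lambda>\<rho>. \<forall>k\<in>{..h}. \<forall>b. (Succ ^^ k) b \<approx> \<rho> x \<longrightarrow> P (\<rho>(x := b)))"
  have "PiD (Suc n) (\<lambda>\<rho>. \<forall>b. (Succ ^^ k) b \<approx> \<rho> x \<longrightarrow> P (\<rho>(x := b)))" for k
  proof -
    let ?\<sigma> = "\<lambda>j. if j = x then Var 0 else Var (Suc j)"
    have t: "subst_tm \<rho> ((Succ ^^ k) u) = (Succ ^^ k) (subst_tm \<rho> u)" for \<rho> u by (induction k) auto
    have upd: "(\<lambda>j. subst_tm (case_nat b \<rho>) (?\<sigma> j)) = \<rho>(x := b)" for b \<rho> by auto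
    have "PiD (Suc n) (\<lambda>\<rho>. \<not> (Succ ^^ k) (\<rho> 0) \<approx> \<rho> (Suc x))"
      using PiD_bounded[of "Imp (Eq ((Succ ^^ k) (Var 0)) (Var (Suc x))) Bot" "Suc n"]
      by (simp add: bounded_fm.intros t)
    from PiD_All[OF PiD_disj_conj[OF this PiD_subst[OF P, of ?\<sigma>], THEN conjunct1]]
    have "PiD (Suc n) (\<lambda>\<rho>. \<forall>b. \<not> (Succ ^^ k) b \<approx> \<rho> x \<or> P (\<rho>(x := b)))"
      unfolding upd by simp
    then show ?thesis by (simp only: imp_conv_disj)
  qed
  then have "PiD (Suc n) Q" unfolding Q_def by (intro PiD_Ball) auto
  moreover have "Q (\<rho>(x := Zero))"
    unfolding Q_def
  proof (intro ballI allI impI)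
    fix k b assume k: "(Succ ^^ k) b \<approx> (\<rho>(x := Zero)) x"
    then have "k = 0" using not_Succ_eqv_Zero by (cases k) auto
    then have "b \<approx> Zero" using k by simp
    \<comment> \<open>Nothing lies below zero, so the hypothesis of \<open>step\<close> is
      vacuous.\<close>
    have False if "1 \<le> j" "(Succ ^^ j) c \<approx> b" for j c
      using eqv_trans[OF that(2) \<open>b \<approx> Zero\<close>] that(1) not_Succ_eqv_Zero by (cases j) auto
    then show "P (\<rho>(x := Zero, x := b))" using step by fastforce
  qed
  moreover have "Q (\<rho>(x := Succ a))" if "Q (\<rho>(x := a))" for a
    unfolding Q_def
  proof (intro ballI allI impI)
    have Qa: "P (\<rho>(x := b))" if "k \<le> h" "(Succ ^^ k) b \<approx> a" for k b
      using \<open>Q (\<rho>(x := a))\<close> that unfolding Q_def by simp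
    have pred: "P (\<rho>(x := b))" if "1 \<le> k" "k \<le> h" "(Succ ^^ k) b \<approx> Succ a" for k b
    proof -
      obtain j where "k = Suc j" using \<open>1 \<le> k\<close> by (cases k) auto
      then show ?thesis using Qa[of j b] that Succ_eqv_SuccD by simp
    qed
    fix k b assume k: "k \<in> {..h}" "(Succ ^^ k) b \<approx> (\<rho>(x := Succ a)) x"
    show "P (\<rho>(x := Succ a, x := b))"
    proof (cases "k = 0")
      case True
      then have b: "b \<approx> Succ a" using k by simp
      \<comment> \<open>Since \<open>b\<close> need only be \<approx>-equal to
        \<open>Succ a\<close>, \<open>step\<close> is applied at \<open>b\<close> itself.\<close>
      have "P (\<rho>(x := b))"
        by (rule step) (use pred eqv_trans[OF _ b] in blast)
      then show ?thesis by simp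
    next
      case False
      then show ?thesis using pred[of k b] k by simp
    qed
  qed
  ultimately have "Q (\<rho>(x := a))" by (rule PiD_induct)
  from this[unfolded Q_def, rule_format, of 0 a] show ?thesis by (simp add: eqv_refl)
qed

end


section \<open>Walks in the proof graph\<close>

lemma subtree_append: "subtree t p = Some u \<Longrightarrow> subtree t (p @ q) = subtree u q"
proof (induction p arbitrary: t)
  case (Cons i p)
  then show ?case by (cases t) (auto split: if_splits)
qed simp

definition nodes :: "ptree \<Rightarrow> nat list set" where
  "nodes t = {p. subtree t p \<noteq> None}"

lemma nodes_appendD: "p @ q \<in> nodes t \<Longrightarrow> p \<in> nodes t"
proof (induction p arbitrary: t)
  case Nil
  then show ?case by (simp add: nodes_def)
next
  case (Cons i p)
  then show ?case by (cases t) (auto simp: nodes_def split: if_splits)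
qed

lemma finite_nodes: "finite (nodes t)"
proof (induction t)
  case (Bud c)
  have "nodes (Bud c) \<subseteq> {[]}"
  proof
    show "p \<in> {[]}" if "p \<in> nodes (Bud c)" for p using that by (cases p) (auto simp: nodes_def)
  qed
  then show ?case by (rule finite_subset) simp
next
  case (Infer r c ts)
  have "nodes (Infer r c ts) \<subseteq> insert [] (\<Union>i<length ts. Cons i ` nodes (ts ! i))"
  proof
    show "p \<in> insert [] (\<Union>i<length ts. Cons i ` nodes (ts ! i))" if "p \<in> nodes (Infer r c ts)" for p
      using that by (cases p) (auto simp: nodes_def split: if_splits)
  qed
  then show ?case by (rule finite_subset) (use Infer in auto)
qed

definition edge :: "ptree \<Rightarrow> (nat list \<rightharpoonup> nat list) \<Rightarrow> nat list \<Rightarrow> nat list \<Rightarrow> bool" where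
  "edge t \<beta> p q \<longleftrightarrow> (\<exists>j. q = p @ [j] \<and> q \<in> nodes t) \<or> \<beta> p = Some q"

text \<open>Child 1 is the premise for Sx; along these edges the value of \<open>x\<close> drops by
  one.\<close>

definition succ_edge :: "ptree \<Rightarrow> nat \<Rightarrow> nat list \<Rightarrow> nat list \<Rightarrow> bool" where
  "succ_edge t x p q \<longleftrightarrow> p \<in> rule_nodes t (\<lambda>r. r = Case x) \<and> q = p @ [1]"

text \<open>The list omits the end point, so walks are joined by plain concatenation and a closed
  walk is repeated without doubling a vertex.\<close>

definition leads :: "('a \<times> 'a) set \<Rightarrow> 'a \<Rightarrow> 'a list \<Rightarrow> 'a \<Rightarrow> bool" where
  "leads E p ws q \<longleftrightarrow>
    ws \<noteq> [] \<and> hd ws = p \<and> successively (\<lambda>a b. (a, b) \<in> E) ws \<and> (last ws, q) \<in> E"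

lemma leads_append: "leads E p ws q \<Longrightarrow> leads E q vs r \<Longrightarrow> leads E p (ws @ vs) r"
  by (auto simp: leads_def successively_append_iff)

lemma trancl_leads: "(p, q) \<in> E\<^sup>+ \<Longrightarrow> \<exists>ws. leads E p ws q"
proof (induction rule: trancl_induct)
  case (base q)
  then have "leads E p [p] q" by (simp add: leads_def)
  then show ?case ..
next
  case (step q r)
  then obtain ws where "leads E p ws q" by blast
  moreover have "leads E q [q] r" using step by (simp add: leads_def)
  ultimately have "leads E p (ws @ [q]) r" by (rule leads_append)
  then show ?case ..
qed

text \<open>Each further vertex is added by a detour from \<open>p\<close> to it and back.\<close>

lemma covering_closed_walk:
  assumes "finite A" "A \<subseteq> C" "p \<in> C" "\<And>a b. a \<in> C \<Longrightarrow> b \<in> C \<Longrightarrow> (a, b) \<in> E\<^sup>+"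
  shows "\<exists>ws. leads E p ws p \<and> A \<subseteq> set ws"
  using assms(1,2)
proof (induction rule: finite_induct)
  case empty
  then show ?case using trancl_leads[OF assms(4)[OF assms(3,3)]] by simp
next
  case (insert a A)
  then obtain ws where ws: "leads E p ws p" "A \<subseteq> set ws" by auto
  have a: "a \<in> C" using insert.prems by simp
  obtain us where us: "leads E p us a" using trancl_leads[OF assms(4)[OF assms(3) a]] ..
  obtain vs where vs: "leads E a vs p" using trancl_leads[OF assms(4)[OF a assms(3)]] ..
  have "a \<in> set vs" using vs by (auto simp: leads_def)
  then show ?case using ws(2) leads_append[OF ws(1) leads_append[OF us vs]]
    by (intro exI[of _ "ws @ us @ vs"]) auto
qed

text \<open>A closed walk through all of \<open>C\<close> is repeated for ever.\<close>

lemma recurrent_walk: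
  assumes "finite C" "p \<in> C" "\<And>a b. a \<in> C \<Longrightarrow> b \<in> C \<Longrightarrow> (a, b) \<in> E\<^sup>+"
  obtains f :: "nat \<Rightarrow> 'a" where "f 0 = p" "\<And>i. (f i, f (Suc i)) \<in> E" "\<And>a m. a \<in> C \<Longrightarrow> \<exists>i\<ge>m. f i = a"
proof -
  obtain ws where ws: "leads E p ws p" "C \<subseteq> set ws"
    using covering_closed_walk[OF assms(1) subset_refl assms(2,3)] by blast
  have len: "length ws > 0" using ws(1) by (auto simp: leads_def)
  let ?f = "\<lambda>i. ws ! (i mod length ws)"
  have "?f 0 = p" using ws(1) by (auto simp: leads_def hd_conv_nth)
  moreover have "(?f i, ?f (Suc i)) \<in> E" for i
  proof (cases "Suc (i mod length ws) = length ws")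
    case True
    then have "?f i = last ws" using len by (metis diff_Suc_1 last_conv_nth length_greater_0_conv)
    moreover have "?f (Suc i) = p" using True ws(1) by (auto simp: mod_Suc leads_def hd_conv_nth)
    ultimately show ?thesis using ws(1) by (simp add: leads_def)
  next
    case False
    then have "Suc (i mod length ws) < length ws" using len by (simp add: Suc_lessI)
    then show ?thesis using ws(1) False by (simp add: leads_def successively_conv_nth mod_Suc)
  qed
  moreover have "\<exists>i\<ge>m. ?f i = a" if "a \<in> C" for a m
  proof -
    obtain k where "k < length ws" "ws ! k = a" using \<open>a \<in> C\<close> ws(2) by (metis in_mono in_set_conv_nth)
    moreover have "m \<le> k + m * length ws" using len by (cases "length ws") simp_all
    ultimately show ?thesis by (intro exI[of _ "k + m * length ws"]) simp
  qed
  ultimately show ?thesis by (rule that)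
qed

section \<open>Variables decreased in strongly connected subgraphs\<close>

lemma subst_seq_Zero_fresh: "x \<notin> fv_seq (subst_seq (Var(x := Zero)) c)"
proof -
  have "x \<notin> fv (subst (Var(x := Zero)) \<phi>)" for \<phi>
    using fv_subst[of "Var(x := Zero)" \<phi>] by (auto split: if_splits)
  then show ?thesis by (auto simp: fv_seq_def fv_fset_def subst_seq_def)
qed

text \<open>The zero premise no longer contains \<open>x\<close>, so an edge that keeps
  \<open>x\<close> free has to go to the successor premise.\<close>

lemma Case_successor:
  assumes "CPA_proof t \<beta>" "p \<in> rule_nodes t (\<lambda>r. r = Case x)" "edge t \<beta> p q"
    and "x \<in> fv_seq (node_seq t q)"
  shows "succ_edge t x p q"
proof -
  obtain c ts where sub: "subtree t p = Some (Infer (Case x) c ts)"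
    using assms(2) by (auto simp: rule_nodes_def)
  have "rule_instance (Case x) (map root_seq ts) c"
    using assms(1) sub unfolding CPA_proof_def CPA_preproof_def locally_correct_def by blast
  then have ts: "map root_seq ts =
      [subst_seq (Var(x := Zero)) c, subst_seq (Var(x := Succ (Var x))) c]"
    by (auto elim: rule_instance.cases)
  have "p \<notin> dom \<beta>"
    using assms(1) sub by (auto simp: CPA_proof_def CPA_preproof_def bud_nodes_def)
  then obtain j where q: "q = p @ [j]" "q \<in> nodes t"
    using assms(3) by (auto simp: edge_def)
  then have j: "j < length ts"
    using subtree_append[OF sub, of "[j]"] by (auto simp: nodes_def split: if_splits)
  then have "node_seq t q = map root_seq ts ! j"
    using subtree_append[OF sub, of "[j]"] by (simp add: node_seq_def q)
  then have "x \<in> fv_seq ([subst_seq (Var(x := Zero)) c, subst_seq (Var(x := Succ (Var x))) c] ! j)"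
    using assms(4) ts by simp
  then have "j \<noteq> 0" using subst_seq_Zero_fresh by (cases j) auto
  moreover have "length ts = 2" using arg_cong[OF ts, of length] by simp
  ultimately have "j = 1" using j by simp
  then show ?thesis using assms(2) q by (simp add: succ_edge_def)
qed

text \<open>The trace condition is applied to a branch visiting every vertex of \<open>C\<close>
  infinitely often. Its variable is then free in all of \<open>C\<close>, and one of its Case
  instances is passed along an edge of \<open>E\<close>.\<close>

lemma strongly_connected_leader:
  assumes cpa: "CPA_proof t \<beta>" and "C \<subseteq> nodes t" "C \<noteq> {}" "E \<subseteq> C \<times> C"
    and edges: "\<And>p q. (p, q) \<in> E \<Longrightarrow> edge t \<beta> p q"
    and conn: "\<And>a b. a \<in> C \<Longrightarrow> b \<in> C \<Longrightarrow> (a, b) \<in> E\<^sup>+"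
  obtains x p q where "\<And>p. p \<in> C \<Longrightarrow> x \<in> fv_seq (node_seq t p)" "(p, q) \<in> E" "succ_edge t x p q"
proof -
  obtain r where r: "r \<in> C" using assms(3) by blast
  have "finite C" using assms(2) finite_nodes by (rule finite_subset)
  then obtain f where f: "f 0 = r" "\<And>i. (f i, f (Suc i)) \<in> E" "\<And>a m. a \<in> C \<Longrightarrow> \<exists>i\<ge>m. f i = a"
    using recurrent_walk[OF _ r conn] by blast
  \<comment> \<open>The branch climbs from the root to \<open>r\<close> through the prefixes of the
    address \<open>r\<close> and then follows \<open>f\<close>.\<close>
  define b where "b = (\<lambda>i. if i < length r then take i r else f (i - length r))"
  have b_shift: "b (length r + i) = f i" for i by (simp add: b_def)
  have "infinite_branch t \<beta> b"
    unfolding infinite_branch_def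
  proof (intro conjI allI)
    show "b 0 = []" using f(1) by (auto simp: b_def)
    fix i
    have "edge t \<beta> (b i) (b (Suc i))"
    proof (cases "i < length r")
      case True
      then have "b (Suc i) = take (Suc i) r" using f(1) by (auto simp: b_def not_less le_Suc_eq)
      moreover have "take (Suc i) r \<in> nodes t"
        using r assms(2) nodes_appendD[of "take (Suc i) r" "drop (Suc i) r"] by auto
      ultimately show ?thesis using True by (simp add: b_def edge_def take_Suc_conv_app_nth)
    next
      case False
      then obtain j where "i = length r + j" using le_Suc_ex not_less by blast
      then show ?thesis using edges[OF f(2)[of j]] b_shift[of j] b_shift[of "Suc j"] by simp
    qed
    then show "(\<exists>j. b (Suc i) = b i @ [j] \<and> subtree t (b (Suc i)) \<noteq> None) \<or> \<beta> (b i) = Some (b (Suc i))"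
      by (auto simp: edge_def nodes_def)
  qed
  then obtain x where x: "\<forall>\<^sub>\<infinity>i. x \<in> fv_seq (node_seq t (b i))"
      "\<exists>\<^sub>\<infinity>i. b i \<in> rule_nodes t (\<lambda>r. r = Case x)"
    using cpa unfolding CPA_proof_def by blast
  obtain m where m: "\<And>i. i \<ge> m \<Longrightarrow> x \<in> fv_seq (node_seq t (b i))"
    using x(1) by (auto simp: MOST_nat_le)
  have fv: "x \<in> fv_seq (node_seq t p)" if "p \<in> C" for p
  proof -
    obtain i where "i \<ge> m" "f i = p" using f(3)[OF \<open>p \<in> C\<close>] by blast
    then show ?thesis using m[of "length r + i"] b_shift[of i] by simp
  qed
  \<comment> \<open>Only a passage after the initial climb belongs to the walk
    \<open>f\<close>.\<close>
  obtain i where i: "i \<ge> length r" "b i \<in> rule_nodes t (\<lambda>r. r = Case x)"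
    using x(2) by (auto simp: INFM_nat_le)
  define j where "j = i - length r"
  have "f j \<in> rule_nodes t (\<lambda>r. r = Case x)" using i b_shift[of j] by (simp add: j_def)
  moreover have "f (Suc j) \<in> C" using f(2)[of j] assms(4) by blast
  ultimately have "succ_edge t x (f j) (f (Suc j))"
    using Case_successor[OF cpa _ edges[OF f(2)] fv] by blast
  then show ?thesis using that fv f(2) by blast
qed


section \<open>Soundness of cyclic proofs in a Henkin set\<close>

context henkin_set
begin

text \<open>Off the decreasing edges values agree literally, not only up to \<approx>, so frozen
  variables can be compared with fixed values by equality. Variables not free at \<open>p\<close>
  are unconstrained, which leaves room for eigenvariables.\<close>

definition refuted_by :: "ptree \<Rightarrow> nat list \<Rightarrow> (nat \<Rightarrow> tm) \<Rightarrow> nat list \<Rightarrow> (nat \<Rightarrow> tm) \<Rightarrow> bool" where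
  "refuted_by t p \<rho> q \<rho>' \<longleftrightarrow> \<not> tru \<rho>' (node_seq t q) \<and>
    (\<forall>z\<in>fv_seq (node_seq t p). if succ_edge t z p q then Succ (\<rho>' z) \<approx> \<rho> z else \<rho>' z = \<rho> z)"

lemma refuted_step:
  assumes "CPA_proof t \<beta>" "p \<in> nodes t" "\<not> tru \<rho> (node_seq t p)"
  shows "\<exists>q \<rho>'. edge t \<beta> p q \<and> refuted_by t p \<rho> q \<rho>'"
proof -
  have cpa: "CPA_preproof t \<beta>" using assms(1) by (simp add: CPA_proof_def)
  obtain u where u: "subtree t p = Some u" using assms(2) by (auto simp: nodes_def)
  show ?thesis
  proof (cases u)
    case (Bud c)
    then have "p \<in> dom \<beta>" using u cpa by (simp add: bud_nodes_def CPA_preproof_def)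
    then obtain q where q: "\<beta> p = Some q" by blast
    then have "node_seq t p = node_seq t q" using cpa by (auto simp: CPA_preproof_def)
    moreover have "\<not> succ_edge t z p q" for z using u Bud by (auto simp: succ_edge_def rule_nodes_def)
    ultimately have "refuted_by t p \<rho> q \<rho>" using assms(3) by (simp add: refuted_by_def)
    then show ?thesis using q by (auto simp: edge_def)
  next
    case (Infer r c ts)
    have c: "node_seq t p = c" using u Infer by (simp add: node_seq_def)
    have succ: "succ_edge t z p q \<longleftrightarrow> r = Case z \<and> q = p @ [1]" for z q
      using u Infer by (auto simp: succ_edge_def rule_nodes_def)
    have child: "edge t \<beta> p (p @ [i])" "node_seq t (p @ [i]) = root_seq (ts ! i)" if "i < length ts" for i
      using subtree_append[OF u, of "[i]"] that Infer by (auto simp: edge_def nodes_def node_seq_def)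
    have rule: "rule_instance r (map root_seq ts) c"
      using cpa u unfolding Infer CPA_preproof_def locally_correct_def by blast
    then show ?thesis
    proof (cases rule: rule_instance.cases)
      case 1
      obtain i \<rho>' where i: "i < length ts" "\<not> tru \<rho>' (root_seq (ts ! i))" "\<forall>z\<in>fv_seq c. \<rho>' z = \<rho> z"
        using common_rule_step[OF 1(2), of \<rho>] assms(3) c by (auto simp: in_set_conv_nth)
      then have "refuted_by t p \<rho> (p @ [i]) \<rho>'" using child succ 1(1) c by (simp add: refuted_by_def)
      then show ?thesis using child i by blast
    next
      case (2 \<phi> s)
      then have "p \<in> rule_nodes t is_Induction" using u Infer by (auto simp: rule_nodes_def)
      then show ?thesis using cpa by (auto simp: CPA_preproof_def)
    next
      case (3 x)
      have len: "length ts = 2" using arg_cong[OF 3(2), of length] by simp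
      have seqs: "root_seq (ts ! 0) = subst_seq (Var(x := Zero)) c"
        "root_seq (ts ! 1) = subst_seq (Var(x := Succ (Var x))) c"
        using arg_cong[OF 3(2), of "\<lambda>l. l ! 0"] arg_cong[OF 3(2), of "\<lambda>l. l ! 1"] len by simp_all
      \<comment> \<open>Case is sound because every element of \<open>T\<close> is zero or a
        successor; only in the second case does the value of \<open>x\<close> drop.\<close>
      from Zero_or_Succ[of "\<rho> x"] show ?thesis
      proof (elim disjE exE)
        assume "\<rho> x \<approx> Zero"
        then have "tru (\<lambda>k. subst_tm \<rho> ((Var(x := Zero)) k)) c \<longleftrightarrow> tru \<rho> c"
          by (intro tru_eqv_cong) (auto simp: eqv_refl eqv_sym)
        then have "refuted_by t p \<rho> (p @ [0]) \<rho>"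
          using assms(3) c child(2)[of 0] len seqs(1) succ by (simp add: refuted_by_def tru_subst)
        then show ?thesis using child(1)[of 0] len by auto
      next
        fix b assume b: "\<rho> x \<approx> Succ b"
        let ?\<rho> = "\<rho>(x := b)"
        have "tru (\<lambda>k. subst_tm ?\<rho> ((Var(x := Succ (Var x))) k)) c \<longleftrightarrow> tru \<rho> c"
          using b by (intro tru_eqv_cong) (auto simp: eqv_refl eqv_sym)
        then have "refuted_by t p \<rho> (p @ [1]) ?\<rho>"
          using assms(3) c child(2)[of 1] len seqs(2) succ 3(1) eqv_sym[OF b]
          by (simp add: refuted_by_def tru_subst)
        then show ?thesis using child(1)[of 1] len by auto
      qed
    qed
  qed
qed

text \<open>
  The variables in \<open>X\<close> are those whose induction is already under way: they keep the value given by
  \<open>\<rho>0\<close> along every edge of \<open>E\<close>. A strongly connected graph has a variable \<open>x\<close> on which one can induct,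
  and for each value of \<open>x\<close> only the edges that do not decrease \<open>x\<close> remain.
\<close>

lemma closed_subgraph_sound:
  assumes cpa: "CPA_proof t \<beta>" and Pi: "\<And>p. p \<in> dom \<beta> \<Longrightarrow> Pi_seq n (node_seq t p)"
    and "C \<subseteq> nodes t" "E \<subseteq> C \<times> C" "\<And>p q. (p, q) \<in> E \<Longrightarrow> edge t \<beta> p q"
    and "\<And>p. p \<in> C \<Longrightarrow> X \<subseteq> fv_seq (node_seq t p)"
    and "\<And>p q z. (p, q) \<in> E \<Longrightarrow> z \<in> X \<Longrightarrow> \<not> succ_edge t z p q"
    and "\<And>p \<rho>. p \<in> C \<Longrightarrow> \<forall>z\<in>X. \<rho> z = \<rho>0 z \<Longrightarrow> \<not> tru \<rho> (node_seq t p) \<Longrightarrow>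
      \<exists>q \<rho>'. (p, q) \<in> E \<and> refuted_by t p \<rho> q \<rho>'"
    and "p \<in> C" "\<forall>z\<in>X. \<rho> z = \<rho>0 z"
  shows "tru \<rho> (node_seq t p)"
  using assms(3-)
\<comment> \<open>Graphs that are not strongly connected lose vertices, the others lose their
  decreasing edges; both lower this measure.\<close>
proof (induction "card E + card C" arbitrary: C E X \<rho>0 p \<rho> rule: less_induct)
  case less
  note C = less.prems(1) and E = less.prems(2) and edges = less.prems(3) and X = less.prems(4)
    and frozen = less.prems(5) and step = less.prems(6)
  have fin: "finite C" "finite E"
    using C E finite_nodes finite_subset by (blast, metis finite_SigmaI finite_nodes finite_subset)
  have agree: "\<forall>z\<in>X. \<rho>' z = \<rho>0 z"
    if "(p, q) \<in> E" "\<forall>z\<in>X. \<rho> z = \<rho>0 z" "refuted_by t p \<rho> q \<rho>'" for p q \<rho> \<rho>'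
  proof
    fix z assume "z \<in> X"
    moreover have "z \<in> fv_seq (node_seq t p)" using X E \<open>(p, q) \<in> E\<close> \<open>z \<in> X\<close> by blast
    ultimately show "\<rho>' z = \<rho>0 z" using that frozen unfolding refuted_by_def by metis
  qed
  show ?case
  proof (cases "\<exists>a\<in>C. \<exists>b\<in>C. (a, b) \<notin> E\<^sup>*")
    case True
    then obtain a b where ab: "a \<in> C" "b \<in> C" "(a, b) \<notin> E\<^sup>*" by blast
    \<comment> \<open>\<open>R\<close> is closed under the edges and lacks \<open>b\<close>. Once it
      is known to be sound, falsity cannot enter it, so \<open>C - R\<close> can be treated as a
      graph of its own.\<close>
    define R where "R = {q \<in> C. (a, q) \<in> E\<^sup>*}"
    have restrict: "tru \<rho> (node_seq t p)"
      if "S \<subset> C" "p \<in> S" "\<forall>z\<in>X. \<rho> z = \<rho>0 z"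
        and S: "\<And>p q \<rho> \<rho>'. p \<in> S \<Longrightarrow> (p, q) \<in> E \<Longrightarrow> \<forall>z\<in>X. \<rho> z = \<rho>0 z \<Longrightarrow>
          refuted_by t p \<rho> q \<rho>' \<Longrightarrow> q \<in> S" for S p \<rho>
    proof (rule less.hyps[of "E \<inter> S \<times> S" S X \<rho>0])
      have "card S < card C" using psubset_card_mono[OF fin(1) \<open>S \<subset> C\<close>] .
      moreover have "card (E \<inter> S \<times> S) \<le> card E" by (rule card_mono[OF fin(2)]) blast
      ultimately show "card (E \<inter> S \<times> S) + card S < card E + card C" by simp
      show "\<exists>q \<rho>'. (p, q) \<in> E \<inter> S \<times> S \<and> refuted_by t p \<rho> q \<rho>'"
        if p: "p \<in> S" "\<forall>z\<in>X. \<rho> z = \<rho>0 z" "\<not> tru \<rho> (node_seq t p)" for p \<rho>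
      proof -
        have "p \<in> C" using p(1) \<open>S \<subset> C\<close> by blast
        then obtain q \<rho>' where "(p, q) \<in> E" "refuted_by t p \<rho> q \<rho>'" using step p(2,3) by blast
        then show ?thesis using S[OF p(1) _ p(2)] p(1) by blast
      qed
      show "X \<subseteq> fv_seq (node_seq t p)" if "p \<in> S" for p using X that \<open>S \<subset> C\<close> by blast
    qed (use that(1-3) C edges frozen in auto)
    have "q \<in> R" if "p \<in> R" "(p, q) \<in> E" for p q
      using that E unfolding R_def by (auto intro: rtrancl_into_rtrancl)
    moreover have "R \<subset> C" using ab unfolding R_def by blast
    ultimately have R: "tru \<rho> (node_seq t p)" if "p \<in> R" "\<forall>z\<in>X. \<rho> z = \<rho>0 z" for p \<rho>
      using that by (intro restrict[of R]) auto
    have "q \<in> C - R" if "(p, q) \<in> E" "\<forall>z\<in>X. \<rho> z = \<rho>0 z" "refuted_by t p \<rho> q \<rho>'" for p q \<rho> \<rho>'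
    proof -
      have "\<not> tru \<rho>' (node_seq t q)" using that(3) by (simp add: refuted_by_def)
      then have "q \<notin> R" using R agree[OF that] by blast
      then show ?thesis using E that(1) by blast
    qed
    moreover have "C - R \<subset> C" using ab(1) unfolding R_def by blast
    ultimately have "tru \<rho> (node_seq t p)" if "p \<in> C - R" "\<forall>z\<in>X. \<rho> z = \<rho>0 z" for p \<rho>
      using that by (intro restrict[of "C - R"]) blast+
    then show ?thesis using R less.prems(7,8) by blast
  next
    case False
    then have conn: "(a, b) \<in> E\<^sup>*" if "a \<in> C" "b \<in> C" for a b using that by blast
    show ?thesis
    proof (rule ccontr)
      assume "\<not> tru \<rho> (node_seq t p)"
      \<comment> \<open>A false node has an outgoing edge. This excludes a single vertex without
        edges, so paths can be chosen nonempty.\<close>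
      then obtain p0 q0 where e0: "(p0, q0) \<in> E" using step less.prems(7,8) by blast
      have "(a, b) \<in> E\<^sup>+" if "a \<in> C" "b \<in> C" for a b
      proof -
        have "(a, p0) \<in> E\<^sup>*" "(q0, b) \<in> E\<^sup>*" using conn that e0 E by auto
        then show ?thesis using e0 by (meson rtrancl_into_trancl1 trancl_rtrancl_trancl)
      qed
      moreover have "C \<noteq> {}" using less.prems(7) by blast
      ultimately obtain x p1 q1 where x: "\<And>p. p \<in> C \<Longrightarrow> x \<in> fv_seq (node_seq t p)"
          and e1: "(p1, q1) \<in> E" "succ_edge t x p1 q1"
        using strongly_connected_leader[OF cpa C _ E edges] by blast
      \<comment> \<open>An edge of \<open>E\<close> decreases \<open>x\<close>, and none decreases a
        frozen variable.\<close>
      have xX: "x \<notin> X" using frozen e1 by blast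
      define E' where "E' = {(p, q) \<in> E. \<not> succ_edge t x p q}"
      have "E' \<subset> E" using e1 unfolding E'_def by blast
      then have card: "card E' + card C < card E + card C" using psubset_card_mono[OF fin(2)] by simp
      \<comment> \<open>The variables over whose values the induction predicate has to generalise:
        neither frozen nor \<open>x\<close> itself.\<close>
      define W where "W = (\<Union>p\<in>C. fv_seq (node_seq t p)) - insert x X"
      have "finite W" using fin(1) finite_fv_seq by (auto simp: W_def)
      \<comment> \<open>Speaking only of buds keeps the induction predicate \<Pi>_{n+1}; other nodes
        may carry formulas of any complexity.\<close>
      define B where "B = C \<inter> dom \<beta>"
      define P where "P = (\<lambda>\<rho>. \<forall>\<rho>'. (\<forall>z. z \<notin> W \<longrightarrow> \<rho>' z = \<rho> z) \<longrightarrow> (\<forall>p\<in>B. tru \<rho>' (node_seq t p)))"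
      have P: "PiD (Suc n) P"
        unfolding P_def using \<open>finite W\<close> fin(1) Pi
        by (intro PiD_all_on PiD_Ball PiD_tru) (auto simp: B_def)
      have P_D: "tru \<rho> (node_seq t p)"
        if "P (\<rho>0(x := a))" "p \<in> B" "\<forall>z\<in>X. \<rho> z = \<rho>0 z" "\<rho> x = a" for a p \<rho>
      proof -
        let ?\<rho> = "\<lambda>z. if z \<in> W then \<rho> z else (\<rho>0(x := a)) z"
        have "tru ?\<rho> (node_seq t p)" using that(1,2) unfolding P_def by auto
        moreover have "tru ?\<rho> (node_seq t p) \<longleftrightarrow> tru \<rho> (node_seq t p)"
          using that(2-4) by (intro tru_cong) (auto simp: W_def B_def)
        ultimately show ?thesis by blast
      qed
      \<comment> \<open>Every decreasing edge lengthens the address, so the height bounds how far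
        \<open>x\<close> can drop before a bud is met.\<close>
      obtain h where h: "\<And>p. p \<in> nodes t \<Longrightarrow> length p \<le> h"
        using finite_imageI[OF finite_nodes, of length t, THEN finite_nat_set_iff_bounded_le[THEN iffD1]]
        by blast
      have sound_at: "tru \<rho> (node_seq t p)"
        if below: "\<And>k b. 1 \<le> k \<Longrightarrow> k \<le> h \<Longrightarrow> (Succ ^^ k) b \<approx> a \<Longrightarrow> P (\<rho>0(x := b))"
          and "p \<in> C" "\<forall>z\<in>X. \<rho> z = \<rho>0 z" "\<rho> x = a" for a p \<rho>
      proof -
        \<comment> \<open>Here \<open>k\<close> counts the decreases so far. Falsity at
          \<open>q\<close> is pushed up the tree; addresses grow until a bud is met, where
          \<open>below\<close> applies. Each decrease lengthens the address, hence
          \<open>k \<le> length q\<close>.\<close>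
        have smaller: "tru \<rho> (node_seq t q)"
          if "q \<in> C" "\<forall>z\<in>X. \<rho> z = \<rho>0 z" "1 \<le> k" "k \<le> length q" "(Succ ^^ k) (\<rho> x) \<approx> a" for q \<rho> k
          using that
        proof (induction "h - length q" arbitrary: q \<rho> k rule: less_induct)
          case (less q)
          have qh: "length q \<le> h" using h C less.prems(1) by blast
          show ?case
          proof (rule ccontr)
            assume no: "\<not> tru \<rho> (node_seq t q)"
            then obtain r \<rho>' where r: "(q, r) \<in> E" "refuted_by t q \<rho> r \<rho>'"
              using step less.prems(1,2) by blast
            have "P (\<rho>0(x := \<rho> x))" by (rule below[OF less.prems(3) _ less.prems(5)]) (use less.prems(4) qh in simp)
            then have "q \<notin> B" using P_D less.prems(2) no by blast
            then have "\<beta> q = None" using less.prems(1) by (auto simp: B_def)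
            then obtain j where j: "r = q @ [j]" "r \<in> nodes t" using edges[OF r(1)] by (auto simp: edge_def)
            have "r \<in> C" using r(1) E by blast
            moreover have "h - length r < h - length q" using h[OF j(2)] j(1) by simp
            moreover have "\<exists>k. 1 \<le> k \<and> k \<le> length r \<and> (Succ ^^ k) (\<rho>' x) \<approx> a"
            proof (cases "succ_edge t x q r")
              case True
              then have "Succ (\<rho>' x) \<approx> \<rho> x" using r(2) x less.prems(1) unfolding refuted_by_def by metis
              then have "(Succ ^^ Suc k) (\<rho>' x) \<approx> a"
                using eqv_trans[OF Succ_pow_eqv less.prems(5)] by (simp add: funpow_swap1)
              then show ?thesis using less.prems(4) j(1) by (intro exI[of _ "Suc k"]) simp
            next
              case False
              then have "\<rho>' x = \<rho> x" using r(2) x less.prems(1) unfolding refuted_by_def by metis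
              then show ?thesis using less.prems(3-5) j(1) by (intro exI[of _ k]) simp
            qed
            ultimately have "tru \<rho>' (node_seq t r)"
              using less.hyps[of r \<rho>'] agree[OF r(1) less.prems(2) r(2)] by blast
            then show False using r(2) by (simp add: refuted_by_def)
          qed
        qed
        show ?thesis
        \<comment> \<open>The outer induction hypothesis is used with \<open>x\<close> frozen at the
          value \<open>a\<close>.\<close>
        proof (rule less.hyps[OF card, of "insert x X" "\<rho>0(x := a)"])
          show "\<exists>q \<rho>'. (p, q) \<in> E' \<and> refuted_by t p \<rho> q \<rho>'"
            if p: "p \<in> C" "\<forall>z\<in>insert x X. \<rho> z = (\<rho>0(x := a)) z" "\<not> tru \<rho> (node_seq t p)" for p \<rho>
          proof -
            have \<rho>: "\<forall>z\<in>X. \<rho> z = \<rho>0 z" "\<rho> x = a" using p(2) xX by auto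
            obtain q \<rho>' where q: "(p, q) \<in> E" "refuted_by t p \<rho> q \<rho>'" using step p(1,3) \<rho>(1) by blast
            \<comment> \<open>Such an edge would make a node false at a value just below
              \<open>a\<close>, against \<open>smaller\<close>. So refutations stay within
              \<open>E'\<close>.\<close>
            have "\<not> succ_edge t x p q"
            proof
              assume s: "succ_edge t x p q"
              then have "Succ (\<rho>' x) \<approx> a" using q(2) x[OF p(1)] \<rho>(2) unfolding refuted_by_def by metis
              then have "tru \<rho>' (node_seq t q)"
                using smaller[of q \<rho>' 1] agree[OF q(1) \<rho>(1) q(2)] s q(1) E
                by (auto simp: succ_edge_def)
              then show False using q(2) by (simp add: refuted_by_def)
            qed
            then show ?thesis using q by (auto simp: E'_def)
          qed
        qed (use that C E edges X x frozen xX in \<open>auto simp: E'_def\<close>)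
      qed
      \<comment> \<open>Truth of the buds at every value of \<open>x\<close> follows by induction in
        \<open>T\<close> with \<open>sound_at\<close> as its step; \<open>sound_at\<close> then
        carries it to all of \<open>C\<close>.\<close>
      have "P (\<rho>0(x := a))" for a
      proof (rule PiD_bounded_course_induct[OF P])
        fix a assume below: "\<And>k b. 1 \<le> k \<Longrightarrow> k \<le> h \<Longrightarrow> (Succ ^^ k) b \<approx> a \<Longrightarrow> P (\<rho>0(x := b))"
        show "P (\<rho>0(x := a))"
          unfolding P_def
        proof (intro allI impI ballI)
          fix \<rho>' p assume "\<forall>z. z \<notin> W \<longrightarrow> \<rho>' z = (\<rho>0(x := a)) z" and "p \<in> B"
          then show "tru \<rho>' (node_seq t p)"
            using xX by (intro sound_at[OF below]) (auto simp: W_def B_def)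
        qed
      qed
      then have "tru \<rho> (node_seq t p)" using less.prems(7,8) by (intro sound_at) auto
      then show False using \<open>\<not> tru \<rho> (node_seq t p)\<close> by blast
    qed
  qed
qed

text \<open>The whole proof graph, with no variable frozen yet.\<close>

lemma CPA_sound:
  assumes "CPA_proof t \<beta>" "\<And>p. p \<in> dom \<beta> \<Longrightarrow> Pi_seq n (node_seq t p)"
  shows "tru \<rho> (root_seq t)"
proof -
  let ?E = "{(p, q). p \<in> nodes t \<and> q \<in> nodes t \<and> edge t \<beta> p q}"
  have "ran \<beta> \<subseteq> inner_nodes t" using assms(1) by (simp add: CPA_proof_def CPA_preproof_def)
  moreover have "inner_nodes t \<subseteq> nodes t" by (auto simp: inner_nodes_def nodes_def)
  ultimately have target: "q \<in> nodes t" if "edge t \<beta> p q" for p q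
    using that unfolding edge_def by (blast intro: ranI)
  have "tru \<rho> (node_seq t [])"
  proof (rule closed_subgraph_sound[OF assms, of "nodes t" ?E "{}"])
    show "\<exists>q \<rho>'. (p, q) \<in> ?E \<and> refuted_by t p \<rho> q \<rho>'" if "p \<in> nodes t" "\<not> tru \<rho> (node_seq t p)" for p \<rho>
      using refuted_step[OF assms(1) that] target that(1) by blast
  qed (auto simp: nodes_def)
  then show ?thesis by (simp add: node_seq_def)
qed

end

theorem theorem6p6:
  fixes n :: nat and \<Gamma> \<Delta> :: "fm fset"
  assumes "\<exists>t \<beta>. CPA_proof t \<beta> \<and> root_seq t = (\<Gamma>, \<Delta>) \<and>
             (\<forall>p \<in> dom \<beta> \<union> ran \<beta>. Pi_seq n (node_seq t p))"
  shows "\<exists>t. PA_proof t \<and> root_seq t = (\<Gamma>, \<Delta>) \<and>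
           (\<forall>\<phi>. rule_nodes t (\<lambda>r. r = Induction \<phi>) \<noteq> {} \<longrightarrow> Pi_fm (n + 1) \<phi>)"
proof -
  obtain t \<beta> where t: "CPA_proof t \<beta>" "root_seq t = (\<Gamma>, \<Delta>)"
      "\<And>p. p \<in> dom \<beta> \<Longrightarrow> Pi_seq n (node_seq t p)"
    using assms by blast
  have "prv n (\<Gamma>, \<Delta>)"
  proof (rule ccontr)
    assume "\<not> prv n (\<Gamma>, \<Delta>)"
    then obtain T where T: "henkin_set n T" "fset \<Gamma> \<subseteq> T" "fset \<Delta> \<inter> T = {}"
      by (rule henkin_set_exists)
    interpret henkin_set n T by (rule T(1))
    \<comment> \<open>Under the valuation \<open>Var\<close> satisfaction is membership in
      \<open>T\<close>, which contains all of \<Gamma> and nothing of \<Delta>.\<close>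
    have "tru Var (\<Gamma>, \<Delta>)" using CPA_sound[OF t(1,3)] t(2) by simp
    then show False using T(2,3) by (auto simp: tru_def sat_def)
  qed
  from prv_imp_PA_proof[OF this] show ?thesis by simp
qed

end
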